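(* Let $\Phi$ be a finite NCIFS on $X\subset\mathbb R^d$. For $n\ge1$ put \[\underline c_n:=\min_{a\in I^{(n)}}\|D\phi^{(n)}_a\|,\qquad \rho_n:=\max_{a,b\in I^{(n)}}\frac{\|D\phi^{(n)}_a\|}{\|D\phi^{(n)}_b\|},\qquad \tilde Z_n(t):=Z_{n-1}(t)\,(\# I^{(n)})^{t/d}\,\underline c_n^{\,t}.\] If $t\ge0$ satisfies \[\liminf_{n\to\infty}\frac{\tilde Z_n(t)}{1+\log\max_{j\le n}\rho_j}>0,\] then $\operatorname{HD}(J(\Phi))\ge t$.
   Context: Fix $d\in\mathbb N$ and a compact set $X\subset\mathbb R^d$ equal to the closure of its interior, such that $\partial X$ is smooth or $X$ is convex. For a conformal map $\phi$, $\|D\phi\|:=\sup_{x\in X}|\phi'(x)|$, where $|\phi'(x)|$ is the scaling factor of $D\phi(x)$. An NCIFS $\Phi$ on $X$ is a sequence $\Phi^{(1)},\Phi^{(2)},\dots$ with $\Phi^{(j)}=(\phi^{(j)}_i:X\to X)_{i\in I^{(j)}}$, where each $I^{(j)}$ is a finite or countably infinite index set, such that: - (open set condition) $\phi^{(j)}_a(\operatorname{int}X)\cap\phi^{(j)}_b(\operatorname{int}X)=\emptyset$ for all $j$ and distinct $a,b\in I^{(j)}$; - (conformality) there is an open connected $V\supset X$ such that every $\phi^{(j)}_i$ extends to a $C^1$ conformal diffeomorphism of $V$ into $V$; - (bounded distortion) there is $K\ge1$ such that for all $k\le l$ and all $\omega_j\in I^{(j)}$, $\phi=\phi^{(k)}_{\omega_k}\circ\cdots\circ\phi^{(l)}_{\omega_l}$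 satisfies $|\phi'(x)|\le K|\phi'(y)|$ for $x,y\in V$; - (uniform contraction) there is $\eta<1$ with $\|D\phi^{(j)}_i\|\le\eta$ for all $j,i$. $\Phi$ is finite if every $I^{(j)}$ is finite. Write $I^n=\prod_{j=1}^nI^{(j)}$ and $\phi_\omega=\phi^{(1)}_{\omega_1}\circ\cdots\circ\phi^{(n)}_{\omega_n}$ for $\omega\in I^n$. The limit set is $J(\Phi)=\bigcap_{n}\bigcup_{\omega\in I^n}\phi_\omega(X)$. $Z_n(t)=\sum_{\omega\in I^n}\|D\phi_\omega\|^t$, with $Z_0(t)=1$. $\operatorname{HD}$ is Hausdorff dimension. *)

theory Defs
  imports "HOL-Analysis.Analysis"
begin

definition hausdorff_pre :: "real \<Rightarrow> real \<Rightarrow> 'a::metric_space set \<Rightarrow> ennreal" where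
  "hausdorff_pre s \<delta> A =
     (INF U \<in> {U :: nat \<Rightarrow> 'a set. A \<subseteq> (\<Union>i. U i) \<and> (\<forall>i. bounded (U i) \<and> diameter (U i) \<le> \<delta>)}.
        (\<Sum>i. (if U i = {} then 0 else if s = 0 then 1 else ennreal (diameter (U i) powr s))))"

definition hausdorff_measure :: "real \<Rightarrow> 'a::metric_space set \<Rightarrow> ennreal" where
  "hausdorff_measure s A = (SUP \<delta> \<in> {0<..}. hausdorff_pre s \<delta> A)"

definition hausdorff_dim :: "'a::metric_space set \<Rightarrow> ereal" where
  "hausdorff_dim A = Inf {ereal s | s. s \<ge> 0 \<and> hausdorff_measure s A = 0}"

text \<open>C-infinity on an open set: all iterated partial derivatives exist and are continuous.\<close>
coinductive smooth_on :: "'a::euclidean_space set \<Rightarrow> ('a \<Rightarrow> real) \<Rightarrow> bool" for U where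
  "continuous_on U f \<Longrightarrow>
   (\<forall>b\<in>Basis. \<exists>g. (\<forall>x\<in>U. ((\<lambda>h. f (x + h *\<^sub>R b)) has_real_derivative g x) (at 0)) \<and> smooth_on U g)
   \<Longrightarrow> smooth_on U f"

definition smooth_boundary :: "'a::euclidean_space set \<Rightarrow> bool" where
  "smooth_boundary X \<longleftrightarrow>
     (\<forall>p\<in>frontier X. \<exists>U g. open U \<and> p \<in> U \<and> smooth_on U g \<and>
        (\<forall>x\<in>U. \<exists>L. (g has_derivative L) (at x) \<and> (\<exists>v. L v \<noteq> 0)) \<and>
        X \<inter> U = {x \<in> U. g x \<le> 0})"

definition dscale :: "('a::euclidean_space \<Rightarrow> 'a) \<Rightarrow> 'a \<Rightarrow> real" where
  "dscale f x = onorm (frechet_derivative f (at x))"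

definition normD :: "('a::euclidean_space \<Rightarrow> 'a) \<Rightarrow> 'a set \<Rightarrow> real" where
  "normD f X = (SUP x \<in> X. dscale f x)"

definition conformal_at :: "('a::euclidean_space \<Rightarrow> 'a) \<Rightarrow> 'a \<Rightarrow> bool" where
  "conformal_at f x \<longleftrightarrow> f differentiable (at x) \<and>
     (\<exists>c>0. \<forall>v. norm (frechet_derivative f (at x) v) = c * norm v)"

definition conformal_diffeo_into :: "('a::euclidean_space \<Rightarrow> 'a) \<Rightarrow> 'a set \<Rightarrow> bool" where
  "conformal_diffeo_into f V \<longleftrightarrow> f ` V \<subseteq> V \<and> inj_on f V \<and>
     (\<forall>x\<in>V. conformal_at f x) \<and>
     continuous_on V (\<lambda>x. frechet_derivative f (at x)) \<comment> \<open>C1: continuous derivative\<close>"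

definition admissible_X :: "'a::euclidean_space set \<Rightarrow> bool" where
  "admissible_X X \<longleftrightarrow> X \<noteq> {} \<and> compact X \<and> X = closure (interior X) \<and>
     (smooth_boundary X \<or> convex X)"

fun comp_seg :: "(nat \<Rightarrow> 'i \<Rightarrow> 'a \<Rightarrow> 'a) \<Rightarrow> (nat \<Rightarrow> 'i) \<Rightarrow> nat \<Rightarrow> nat \<Rightarrow> 'a \<Rightarrow> 'a" where
  "comp_seg \<phi> w k 0 = id"
| "comp_seg \<phi> w k (Suc n) = comp_seg \<phi> w k n \<circ> \<phi> (k + n) (w (k + n))"

definition words :: "(nat \<Rightarrow> 'i set) \<Rightarrow> nat \<Rightarrow> (nat \<Rightarrow> 'i) set" where
  "words I n = Pi\<^sub>E {1..n} I"

definition NCIFS :: "'a::euclidean_space set \<Rightarrow> (nat \<Rightarrow> 'i set) \<Rightarrow> (nat \<Rightarrow> 'i \<Rightarrow> 'a \<Rightarrow> 'a) \<Rightarrow> bool" where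
  "NCIFS X I \<phi> \<longleftrightarrow> admissible_X X \<and>
     (\<forall>j\<ge>1. I j \<noteq> {} \<and> countable (I j) \<and> (\<forall>i\<in>I j. \<phi> j i ` X \<subseteq> X)) \<and>
     (\<forall>j\<ge>1. \<forall>a\<in>I j. \<forall>b\<in>I j. a \<noteq> b \<longrightarrow> \<phi> j a ` interior X \<inter> \<phi> j b ` interior X = {}) \<and>
     (\<exists>V. open V \<and> connected V \<and> X \<subseteq> V \<and>
        (\<forall>j\<ge>1. \<forall>i\<in>I j. conformal_diffeo_into (\<phi> j i) V) \<and>
        (\<exists>K\<ge>1. \<forall>k l w. 1 \<le> k \<longrightarrow> k \<le> l \<longrightarrow> (\<forall>j\<in>{k..l}. w j \<in> I j) \<longrightarrow>
            (\<forall>x\<in>V. \<forall>y\<in>V. dscale (comp_seg \<phi> w k (Suc l - k)) x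
                              \<le> K * dscale (comp_seg \<phi> w k (Suc l - k)) y))) \<and>
     (\<exists>\<eta><1. \<forall>j\<ge>1. \<forall>i\<in>I j. normD (\<phi> j i) X \<le> \<eta>)"

definition finite_NCIFS :: "'a::euclidean_space set \<Rightarrow> (nat \<Rightarrow> 'i set) \<Rightarrow> (nat \<Rightarrow> 'i \<Rightarrow> 'a \<Rightarrow> 'a) \<Rightarrow> bool" where
  "finite_NCIFS X I \<phi> \<longleftrightarrow> NCIFS X I \<phi> \<and> (\<forall>j\<ge>1. finite (I j))"

definition limit_set :: "'a set \<Rightarrow> (nat \<Rightarrow> 'i set) \<Rightarrow> (nat \<Rightarrow> 'i \<Rightarrow> 'a \<Rightarrow> 'a) \<Rightarrow> 'a set" where
  "limit_set X I \<phi> = (\<Inter>n. \<Union>w\<in>words I n. comp_seg \<phi> w 1 n ` X)"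

definition Zfun :: "'a::euclidean_space set \<Rightarrow> (nat \<Rightarrow> 'i set) \<Rightarrow> (nat \<Rightarrow> 'i \<Rightarrow> 'a \<Rightarrow> 'a) \<Rightarrow> nat \<Rightarrow> real \<Rightarrow> real" where
  "Zfun X I \<phi> n t = (if n = 0 then 1 else (\<Sum>w\<in>words I n. normD (comp_seg \<phi> w 1 n) X powr t))"

end

theory Submission
  imports Defs
begin

text \<open>
  Give each word \<open>u\<close> of length \<open>n\<close> the weight \<open>\<parallel>D\<phi>\<^sub>u\<parallel>\<^sup>t\<close>. The core is a Frostman estimate: for small \<open>r\<close> and all
  large \<open>n\<close>, the words whose image meets a ball of radius \<open>r\<close> carry at most the fraction \<open>C r\<^sup>t\<close> of the
  total weight \<open>Z\<^sub>n(t)\<close>. Since the limit set is a decreasing intersection of compact sets, an open cover of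
  it already covers some finite level, so the Frostman estimate bounds Hausdorff sums from below without
  constructing a limit measure.

  For the Frostman estimate, cut every word at the first level \<open>k + 1\<close> where its scale drops below \<open>r\<close>. By
  a volume argument (the images contain disjoint balls, because \<open>X\<close> satisfies a corkscrew condition), the
  children of one parent at level \<open>k\<close> have \<open>d\<close>-th powers of scales summing to \<open>O(r\<^sup>d)\<close>; the power mean
  inequality converts this into the weight \<open>O(r\<^sup>t / Z~\<^sub>k\<^sub>+\<^sub>1(t))\<close>, which by hypothesis is
  \<open>O(r\<^sup>t / (1 + log M\<^sub>k\<^sub>+\<^sub>1))\<close> where \<open>M\<^sub>n = max\<^sub>j\<^sub>\<le>\<^sub>n \<rho>\<^sub>j\<close>. Parents that are maximal with respect to
  extension are boundedly many, again by volume, and below each of them the parents form a chain: once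
  some child of a word is smaller than \<open>r\<close>, all its children are smaller than \<open>K \<rho> r\<close>, so the chain
  has only \<open>O(1 + log M)\<close> further levels, which the logarithmic denominator absorbs.
\<close>

section \<open>Conformal maps and the corkscrew condition\<close>

text \<open>\<open>dscale\<close> is an operator norm, while conformality provides some factor
  \<open>c\<close>; evaluating at a basis vector shows that the two agree.\<close>

lemma conformal_at_dscale:
  fixes f :: "'a::euclidean_space \<Rightarrow> 'a"
  assumes "conformal_at f x"
  shows "norm (frechet_derivative f (at x) v) = dscale f x * norm v"
    and "dscale f x > 0"
    and "(f has_derivative frechet_derivative f (at x)) (at x)"
proof -
  let ?L = "frechet_derivative f (at x)"
  obtain c where c: "c > 0" "\<And>v. norm (?L v) = c * norm v"
    using assms unfolding conformal_at_def by auto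
  show der: "(f has_derivative ?L) (at x)"
    using assms unfolding conformal_at_def by (simp add: frechet_derivative_works)
  obtain b :: 'a where b: "b \<in> Basis" using nonempty_Basis by blast
  have "onorm ?L \<le> c" using c by (intro onorm_le) auto
  moreover have "norm (?L b) \<le> onorm ?L * norm b"
    by (rule onorm) (use der has_derivative_bounded_linear in blast)
  ultimately have "dscale f x = c" using b c(2)[of b] by (simp add: dscale_def)
  then show "norm (?L v) = dscale f x * norm v" "dscale f x > 0" using c by auto
qed

lemma conformal_at_compose:
  fixes f g :: "'a::euclidean_space \<Rightarrow> 'a"
  assumes g: "conformal_at g x" and f: "conformal_at f (g x)"
  shows "conformal_at (f \<circ> g) x" and "dscale (f \<circ> g) x = dscale f (g x) * dscale g x"
proof -
  have d: "g differentiable at x" "f differentiable at (g x)"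
    using f g by (auto simp: conformal_at_def)
  have eq: "norm (frechet_derivative (f \<circ> g) (at x) v) = (dscale f (g x) * dscale g x) * norm v" for v
    using d by (simp add: frechet_derivative_compose conformal_at_dscale(1)[OF f] conformal_at_dscale(1)[OF g])
  have pos: "dscale f (g x) * dscale g x > 0"
    using conformal_at_dscale(2)[OF f] conformal_at_dscale(2)[OF g] by simp
  show *: "conformal_at (f \<circ> g) x"
    unfolding conformal_at_def using eq pos d by (blast intro: differentiable_chain_at)
  obtain b :: 'a where "b \<in> Basis" using nonempty_Basis by blast
  then show "dscale (f \<circ> g) x = dscale f (g x) * dscale g x"
    using eq[of b] conformal_at_dscale(1)[OF *, of b] by simp
qed

lemma ball_subset_conformal_image:
  fixes f :: "'a::euclidean_space \<Rightarrow> 'a"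
  assumes inj: "inj_on f (ball y s)"
    and conf: "\<And>x. x \<in> ball y s \<Longrightarrow> conformal_at f x"
    and m: "\<And>x. x \<in> ball y s \<Longrightarrow> m \<le> dscale f x" "m > 0" and "s > 0"
  shows "ball (f y) (m * s) \<subseteq> f ` ball y s"
proof (rule ccontr)
  \<comment> \<open>Take the largest ball around \<open>f y\<close> inside the open image. On it the inverse is \<open>1/m\<close>-Lipschitz, so it
      is the image of a compact part of \<open>ball y s\<close> and cannot touch the boundary of the image.\<close>
  let ?S = "f ` ball y s" and ?g = "inv_into (ball y s) f"
  have der: "(f has_derivative frechet_derivative f (at x)) (at x)" if "x \<in> ball y s" for x
    using conformal_at_dscale(3) conf that by blast
  have cont: "continuous_on (ball y s) f"
    using der has_derivative_continuous continuous_at_imp_continuous_on by blast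
  have "open ?S" by (rule invariance_of_domain) (use cont inj in auto)
  assume "\<not> ?thesis"
  then obtain w where w: "dist (f y) w < m * s" "w \<in> - ?S"
    by (meson ComplI mem_ball subsetI)
  have "closed (- ?S)" using \<open>open ?S\<close> by auto
  then obtain w0 where w0: "w0 \<in> - ?S" "infdist (f y) (- ?S) = dist (f y) w0"
    using infdist_attains_inf[of "- ?S" "f y"] w by auto
  define \<rho> where "\<rho> = dist (f y) w0"
  have sub: "ball (f y) \<rho> \<subseteq> ?S"
  proof
    fix z assume z: "z \<in> ball (f y) \<rho>"
    show "z \<in> ?S"
    proof (rule ccontr)
      assume "z \<notin> ?S"
      then have "infdist (f y) (- ?S) \<le> dist (f y) z" by (intro infdist_le) auto
      then show False using z w0 by (simp add: \<rho>_def)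
    qed
  qed
  have "\<rho> < m * s" using w w0 infdist_le[of w "- ?S" "f y"] by (simp add: \<rho>_def)
  have fyS: "f y \<in> ?S" using \<open>s > 0\<close> by auto
  then have "\<rho> > 0" using w0 by (auto simp: \<rho>_def)
  have gder: "\<exists>g'. (?g has_derivative g') (at z) \<and> onorm g' \<le> 1 / m" if z: "z \<in> ?S" for z
  proof -
    obtain x where x: "x \<in> ball y s" "z = f x" using z by auto
    let ?L = "frechet_derivative f (at x)"
    have lin: "linear ?L" using der[OF x(1)] has_derivative_linear by blast
    have nl: "norm (?L v) = dscale f x * norm v" for v
      using conformal_at_dscale(1) conf x(1) by blast
    have ds: "dscale f x \<ge> m" "dscale f x > 0" using m x(1) by fastforce+
    have "inj ?L"
    proof (rule injI)
      fix u v assume "?L u = ?L v"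
      then have "?L (u - v) = 0" using lin by (simp add: linear_diff)
      then show "u = v" using nl[of "u - v"] ds by simp
    qed
    then obtain g' where g': "linear g'" "\<And>v. g' (?L v) = v" "\<And>v. ?L (g' v) = v"
      using linear_injective_isomorphism[OF lin] by auto
    have "(?g has_derivative g') (at (f x))"
      by (rule has_derivative_inverse_strong[where S="ball y s" and f'="?L"])
        (use x inj cont der g' in auto)
    moreover have "onorm g' \<le> 1 / m"
    proof (rule onorm_le)
      fix v
      have "norm v = dscale f x * norm (g' v)" using nl[of "g' v"] g' by simp
      moreover have "m * norm (g' v) \<le> dscale f x * norm (g' v)" using ds by (intro mult_right_mono) auto
      ultimately show "norm (g' v) \<le> 1 / m * norm v" using \<open>m > 0\<close> by (simp add: field_simps)
    qed
    ultimately show ?thesis using x by auto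
  qed
  then obtain g' where g': "\<And>z. z \<in> ?S \<Longrightarrow> (?g has_derivative g' z) (at z)"
      "\<And>z. z \<in> ?S \<Longrightarrow> onorm (g' z) \<le> 1 / m" by metis
  have "ball (f y) \<rho> \<subseteq> f ` cball y (\<rho> / m)"
  proof
    fix z assume z: "z \<in> ball (f y) \<rho>"
    have "norm (?g z - ?g (f y)) \<le> 1 / m * norm (z - f y)"
    proof (rule differentiable_bound[where S="ball (f y) \<rho>" and f'=g'])
      show "(?g has_derivative g' u) (at u within ball (f y) \<rho>)" if "u \<in> ball (f y) \<rho>" for u
        by (rule has_derivative_at_withinI[OF g'(1)[OF subsetD[OF sub that]]])
      show "onorm (g' u) \<le> 1 / m" if "u \<in> ball (f y) \<rho>" for u
        by (intro g'(2) subsetD[OF sub that])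
    qed (use z \<open>\<rho> > 0\<close> in auto)
    also have "\<dots> \<le> \<rho> / m" using z \<open>m > 0\<close> by (simp add: dist_norm norm_minus_commute field_simps)
    finally have "dist y (?g z) \<le> \<rho> / m" using inj \<open>s > 0\<close> by (simp add: dist_norm norm_minus_commute)
    moreover have "f (?g z) = z" using z sub by (meson f_inv_into_f subsetD)
    ultimately show "z \<in> f ` cball y (\<rho> / m)" by (metis image_eqI mem_cball)
  qed
  moreover have sub2: "cball y (\<rho> / m) \<subseteq> ball y s"
    using \<open>\<rho> < m * s\<close> \<open>m > 0\<close> by (simp add: cball_subset_ball_iff field_simps)
  moreover have "compact (f ` cball y (\<rho> / m))"
    using cont sub2 by (intro compact_continuous_image continuous_on_subset[OF cont]) auto
  ultimately have "closure (ball (f y) \<rho>) \<subseteq> f ` cball y (\<rho> / m)"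
    by (intro closure_minimal) (auto simp: compact_imp_closed)
  then have "w0 \<in> f ` cball y (\<rho> / m)" using \<open>\<rho> > 0\<close> by (auto simp: \<rho>_def)
  then have "w0 \<in> ?S" by (rule subsetD[OF image_mono[OF sub2]])
  then show False using w0 by simp
qed

section \<open>The corkscrew condition for convex and for smoothly bounded domains\<close>

text \<open>Shrink one fixed ball \<open>ball c e\<close> of \<open>X\<close> towards
  \<open>x\<close> by the homothety with centre \<open>x\<close> and ratio
  \<open>\<rho> / B\<close>: convexity keeps it in \<open>X\<close>, and since distances in
  \<open>X\<close> are below \<open>B\<close> it lands in \<open>ball x \<rho>\<close>. This gives
  \<open>\<kappa> = e / B\<close> and \<open>R = B\<close>.\<close>

lemma convex_corkscrew:
  fixes X :: "'a::euclidean_space set"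
  assumes "convex X" "bounded X" "interior X \<noteq> {}"
  shows "\<exists>\<kappa>>0. \<exists>R>0. \<forall>x\<in>X. \<forall>\<rho>. 0 < \<rho> \<and> \<rho> \<le> R \<longrightarrow> (\<exists>y. ball y (\<kappa> * \<rho>) \<subseteq> X \<inter> ball x \<rho>)"
proof -
  obtain c e where ce: "e > 0" "ball c e \<subseteq> X"
    using assms(3) by (meson ex_in_conv mem_interior)
  obtain B where B: "B > 0" "\<And>x y. x \<in> X \<Longrightarrow> y \<in> X \<Longrightarrow> dist x y < B"
  proof -
    obtain a r where "X \<subseteq> ball a r" using assms(2) bounded_subset_ballD by blast
    then have "dist x y < 2 * \<bar>r\<bar> + 1" if "x \<in> X" "y \<in> X" for x y
      using that dist_triangle2[of x y a] by (smt (verit) dist_commute mem_ball subsetD)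
    then show ?thesis by (intro that[of "2 * \<bar>r\<bar> + 1"]) auto
  qed
  have "\<exists>y. ball y (e / B * \<rho>) \<subseteq> X \<inter> ball x \<rho>" if x: "x \<in> X" and \<rho>: "0 < \<rho>" "\<rho> \<le> B" for x \<rho>
  proof -
    define l where "l = \<rho> / B"
    have l: "0 < l" "l \<le> 1" using \<rho> B by (auto simp: l_def)
    have "ball (x + l *\<^sub>R (c - x)) (e / B * \<rho>) \<subseteq> X \<inter> ball x \<rho>"
    proof
      fix z assume "z \<in> ball (x + l *\<^sub>R (c - x)) (e / B * \<rho>)"
      then have nz: "norm (z - (x + l *\<^sub>R (c - x))) < l * e" by (simp add: l_def dist_norm norm_minus_commute mult.commute)
      \<comment> \<open>The preimage of \<open>z\<close> under the homothety.\<close>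
      define u where "u = (1 / l) *\<^sub>R (z - x) + x"
      have zu: "z = (1 - l) *\<^sub>R x + l *\<^sub>R u" using l by (simp add: u_def algebra_simps)
      have "z - (x + l *\<^sub>R (c - x)) = l *\<^sub>R (u - c)" by (simp add: zu algebra_simps)
      then have "dist c u < e" using nz l by (simp add: dist_norm norm_minus_commute)
      then have u: "u \<in> X" using ce by auto
      then have "z \<in> X" unfolding zu using assms(1) x l by (intro convexD) auto
      moreover have "z - x = l *\<^sub>R (u - x)" by (simp add: zu algebra_simps)
      then have "norm (z - x) = l * norm (u - x)" using l by simp
      then have "dist x z = l * dist x u" by (simp add: dist_norm norm_minus_commute)
      then have "dist x z < l * B" using B(2)[OF x u] l by simp
      then have "dist x z < \<rho>" using B by (simp add: l_def)
      ultimately show "z \<in> X \<inter> ball x \<rho>" by simp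
    qed
    then show ?thesis by blast
  qed
  then show ?thesis using ce B
    by (intro exI[of _ "e / B"] conjI exI[of _ B]) auto
qed

text \<open>\<open>smooth_on\<close> speaks of partial derivatives along basis vectors only. Its
  rule makes these continuous, uniqueness of derivatives identifies them with \<open>L x b\<close>,
  and linearity passes to an arbitrary \<open>v\<close>.\<close>

lemma smooth_on_derivative_continuous:
  fixes g :: "'a::euclidean_space \<Rightarrow> real"
  assumes "smooth_on U g" "\<And>x. x \<in> U \<Longrightarrow> (g has_derivative L x) (at x)"
  shows "continuous_on U (\<lambda>x. L x v)"
proof -
  have Lb: "continuous_on U (\<lambda>x. L x b)" if b: "b \<in> Basis" for b
  proof -
    obtain h where h: "\<And>x. x \<in> U \<Longrightarrow> ((\<lambda>s. g (x + s *\<^sub>R b)) has_real_derivative h x) (at 0)" "smooth_on U h"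
      using assms(1) b by cases blast
    have "h x = L x b" if x: "x \<in> U" for x
    proof -
      have "((\<lambda>s. g (x + s *\<^sub>R b)) has_derivative (\<lambda>s. L x (s *\<^sub>R b))) (at 0)"
        by (rule has_derivative_compose[of "\<lambda>s. x + s *\<^sub>R b" "\<lambda>s. s *\<^sub>R b" 0 UNIV g "L x"])
          (use assms(2)[OF x] in \<open>auto intro!: derivative_eq_intros\<close>)
      moreover have "L x (s *\<^sub>R b) = L x b * s" for s
        using assms(2)[OF x] has_derivative_linear linear_cmul by (metis mult.commute real_scaleR_def)
      ultimately have "((\<lambda>s. g (x + s *\<^sub>R b)) has_real_derivative L x b) (at 0)"
        by (simp add: has_field_derivative_def)
      then show ?thesis using h(1)[OF x] DERIV_unique by blast
    qed
    moreover have "continuous_on U h" using h(2) by (auto elim: smooth_on.cases)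
    ultimately show ?thesis using continuous_on_cong by (metis (no_types, lifting))
  qed
  have "L x v = (\<Sum>b\<in>Basis. (v \<bullet> b) * L x b)" if x: "x \<in> U" for x
  proof -
    have "linear (L x)" using assms(2)[OF x] has_derivative_linear by blast
    then show ?thesis by (subst (1) euclidean_representation[of v, symmetric])
       (simp add: linear_sum linear_cmul)
  qed
  then have "continuous_on U (\<lambda>x. L x v) \<longleftrightarrow> continuous_on U (\<lambda>x. \<Sum>b\<in>Basis. (v \<bullet> b) * L x b)"
    by (intro continuous_on_cong) auto
  then show ?thesis using Lb by (auto intro!: continuous_intros)
qed

lemma norm_linear_functional_le:
  fixes L :: "'a::euclidean_space \<Rightarrow> real"
  assumes "linear L"
  shows "\<bar>L u\<bar> \<le> (\<Sum>b\<in>Basis. \<bar>L b\<bar>) * norm u"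
proof -
  have "L u = (\<Sum>b\<in>Basis. (u \<bullet> b) * L b)"
    by (subst (1) euclidean_representation[of u, symmetric]) (simp add: assms linear_sum linear_cmul)
  also have "\<bar>\<dots>\<bar> \<le> (\<Sum>b\<in>Basis. \<bar>(u \<bullet> b) * L b\<bar>)" by (rule sum_abs)
  also have "\<dots> \<le> (\<Sum>b\<in>Basis. norm u * \<bar>L b\<bar>)"
    by (intro sum_mono) (auto simp: abs_mult Basis_le_norm intro!: mult_right_mono)
  finally show ?thesis by (simp add: sum_distrib_left mult.commute)
qed

text \<open>Walk from \<open>x\<close> against a direction \<open>e\<close> in which
  \<open>g\<close> increases: near \<open>p\<close> the value of \<open>g\<close> drops at a
  definite rate, and this gain outweighs the variation of \<open>g\<close> across a ball of radius
  \<open>\<kappa> * \<rho>\<close>. By the mean value theorem \<open>g z \<le> g x \<le> 0\<close>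
  on that ball.\<close>

lemma sublevel_corkscrew:
  fixes X :: "'a::euclidean_space set"
  assumes "open U" "p \<in> U" and smooth: "smooth_on U g"
    and der: "\<And>x. x \<in> U \<Longrightarrow> (g has_derivative L x) (at x)"
    and v: "L p v \<noteq> 0" and XU: "X \<inter> U = {x \<in> U. g x \<le> 0}"
  shows "\<exists>\<delta>>0. \<exists>\<kappa>>0. \<exists>R>0. \<forall>x\<in>X \<inter> ball p \<delta>. \<forall>\<rho>. 0 < \<rho> \<and> \<rho> \<le> R \<longrightarrow> (\<exists>y. ball y (\<kappa> * \<rho>) \<subseteq> X \<inter> ball x \<rho>)"
proof -
  have lin: "linear (L x)" if "x \<in> U" for x using der[OF that] has_derivative_linear by blast
  have "v \<noteq> 0" using v linear_0 lin[OF \<open>p \<in> U\<close>] by metis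
  \<comment> \<open>The sign makes \<open>L p e\<close> positive; the length 1/2 leaves room inside
    \<open>ball x \<rho>\<close> for a ball of radius \<open>\<rho> / 2\<close> around
    \<open>x - \<rho> *\<^sub>R e\<close>.\<close>
  define e where "e = (sgn (L p v) / (2 * norm v)) *\<^sub>R v"
  have ne: "norm e = 1 / 2" using v \<open>v \<noteq> 0\<close> by (simp add: e_def abs_sgn_eq)
  define a where "a = L p e"
  have a: "a > 0"
  proof -
    have "L p e = sgn (L p v) / (2 * norm v) * L p v"
      unfolding e_def using lin[OF \<open>p \<in> U\<close>] by (simp add: linear_cmul)
    also have "\<dots> = \<bar>L p v\<bar> / (2 * norm v)" by (simp add: sgn_if)
    finally show ?thesis using v \<open>v \<noteq> 0\<close> by (simp add: a_def)
  qed
  define N where "N = (\<lambda>x. \<Sum>b\<in>Basis. \<bar>L x b\<bar>)"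
  \<comment> \<open>\<open>N\<close> dominates the operator norm of \<open>L\<close>; being larger
    than \<open>N p\<close>, the constant \<open>M\<close> still bounds \<open>N\<close> near
    \<open>p\<close>.\<close>
  define M where "M = N p + 1"
  have M: "M > 0" unfolding M_def N_def by (smt (verit) sum_nonneg abs_ge_zero)
  have "continuous_on U (\<lambda>x. L x e)" "continuous_on U N"
    unfolding N_def using smooth_on_derivative_continuous[OF smooth der]
    by (auto intro!: continuous_intros)
  then have "isCont (\<lambda>x. L x e) p" "isCont N p"
    using \<open>open U\<close> \<open>p \<in> U\<close> continuous_on_eq_continuous_at by blast+
  then have "\<forall>\<^sub>F x in at p. L x e > a / 2" "\<forall>\<^sub>F x in at p. N x < M"
    using a order_tendstoD(1)[of "\<lambda>x. L x e" "L p e" "at p" "a / 2"] order_tendstoD(2)[of N "N p" "at p" M]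
    by (simp_all add: isCont_def a_def M_def)
  moreover have "\<forall>\<^sub>F x in at p. x \<in> U" using \<open>open U\<close> \<open>p \<in> U\<close> by (metis eventually_at_topological)
  ultimately have "\<forall>\<^sub>F x in at p. L x e > a / 2 \<and> N x < M \<and> x \<in> U" by eventually_elim auto
  then obtain d where d: "d > 0" "\<And>x. x \<noteq> p \<Longrightarrow> dist x p < d \<Longrightarrow> L x e > a / 2 \<and> N x < M \<and> x \<in> U"
    unfolding eventually_at by auto
  have D: "L x e > a / 2" "N x < M" "x \<in> U" if "x \<in> ball p d" for x
    using that d(2)[of x] a \<open>p \<in> U\<close> by (cases "x = p"; auto simp: a_def M_def dist_commute)+
  \<comment> \<open>The first bound keeps the small ball in \<open>ball x \<rho>\<close>; the second
    makes the error \<open>M * (\<kappa> * \<rho>)\<close> at most the gain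
    \<open>\<rho> * (a / 2)\<close>.\<close>
  define \<kappa> where "\<kappa> = min (1 / 2) (a / (2 * M))"
  have \<kappa>: "\<kappa> > 0" "\<kappa> \<le> 1 / 2" "\<kappa> * M \<le> a / 2" using a M by (auto simp: \<kappa>_def min_def field_simps)
  have "\<exists>y. ball y (\<kappa> * \<rho>) \<subseteq> X \<inter> ball x \<rho>"
    if x: "x \<in> X \<inter> ball p (d / 2)" and \<rho>: "0 < \<rho>" "\<rho> \<le> d / 2" for x \<rho>
  proof -
    have "ball (x - \<rho> *\<^sub>R e) (\<kappa> * \<rho>) \<subseteq> X \<inter> ball x \<rho>"
    proof
      fix z assume z: "z \<in> ball (x - \<rho> *\<^sub>R e) (\<kappa> * \<rho>)"
      define u where "u = z - (x - \<rho> *\<^sub>R e)"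
      have zx: "z = x + (u - \<rho> *\<^sub>R e)" by (simp add: u_def)
      have u: "norm u < \<kappa> * \<rho>" using z by (simp add: u_def dist_norm norm_minus_commute)
      have "norm (z - x) \<le> norm u + norm (\<rho> *\<^sub>R e)" unfolding zx using norm_triangle_ineq4[of u "\<rho> *\<^sub>R e"] by simp
      also have "\<dots> < \<kappa> * \<rho> + \<rho> / 2" using u \<rho> by (simp add: ne)
      also have "\<dots> \<le> 1 / 2 * \<rho> + \<rho> / 2" using \<kappa> \<rho> by (intro add_mono mult_right_mono) auto
      finally have dz: "dist x z < \<rho>" by (simp add: dist_norm norm_minus_commute)
      have xd: "x \<in> ball p d" using x d by auto
      have zd: "z \<in> ball p d" using x dz \<rho> dist_triangle[of p z x] by auto
      \<comment> \<open>The mean value theorem needs the whole segment where \<open>D\<close> holds;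
        this is why \<open>x\<close> stays within \<open>d / 2\<close> of \<open>p\<close> and
        \<open>\<rho> \<le> d / 2\<close>.\<close>
      have seg: "closed_segment x z \<subseteq> ball p d" using xd zd by (meson closed_segment_subset convex_ball)
      have "\<exists>\<xi>\<in>closed_segment x z. g z - g x = L \<xi> (z - x)"
      proof -
        let ?l = "\<lambda>s. x + s *\<^sub>R (z - x)"
        have lseg: "?l s \<in> closed_segment x z" if "0 \<le> s" "s \<le> 1" for s
          using that by (auto simp: closed_segment_def algebra_simps intro!: exI[of _ s])
        have "((\<lambda>s. g (?l s)) has_derivative (\<lambda>s. L (?l r) (s *\<^sub>R (z - x)))) (at r within {0..1})"
          if "0 \<le> r" "r \<le> 1" for r
          by (rule has_derivative_compose[of ?l "\<lambda>s. s *\<^sub>R (z - x)" r "{0..1}" g "L (?l r)"])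
            (use der[of "?l r"] D(3)[of "?l r"] lseg[OF that] seg in \<open>auto intro!: derivative_eq_intros\<close>)
        from mvt_very_simple[of 0 1, OF _ this] obtain r where
          "r \<in> {0..1}" "g (?l 1) - g (?l 0) = L (?l r) ((1 - 0) *\<^sub>R (z - x))" by auto
        then show ?thesis using lseg[of r] by (intro bexI[of _ "?l r"]) auto
      qed
      then obtain \<xi> where \<xi>: "\<xi> \<in> ball p d" "g z - g x = L \<xi> (z - x)" using seg by blast
      have "L \<xi> (z - x) = L \<xi> u - \<rho> * L \<xi> e"
        using lin[OF D(3)[OF \<xi>(1)]] by (simp add: zx linear_diff linear_cmul)
      also have "\<bar>L \<xi> u\<bar> \<le> N \<xi> * norm u"
        using norm_linear_functional_le[OF lin[OF D(3)[OF \<xi>(1)]]] by (simp add: N_def)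
      also have "N \<xi> * norm u \<le> M * (\<kappa> * \<rho>)" using D(2)[OF \<xi>(1)] u M by (intro mult_mono) auto
      then have "L \<xi> u - \<rho> * L \<xi> e \<le> M * (\<kappa> * \<rho>) - \<rho> * (a / 2)"
        using D(1)[OF \<xi>(1)] \<rho> \<open>\<bar>L \<xi> u\<bar> \<le> N \<xi> * norm u\<close>
        by (smt (verit) mult_left_mono)
      also have "\<dots> = (\<kappa> * M - a / 2) * \<rho>" by (simp add: algebra_simps)
      also have "\<dots> \<le> 0" using \<kappa> \<rho> by (simp add: mult_nonpos_nonneg)
      finally have "g z \<le> g x" using \<xi> by simp
      moreover have "g x \<le> 0" using x XU D(3)[OF xd] by auto
      ultimately have "z \<in> X \<inter> U" unfolding XU using D(3)[OF zd] by simp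
      then show "z \<in> X \<inter> ball x \<rho>" using dz by simp
    qed
    then show ?thesis by blast
  qed
  moreover have "d / 2 > 0" using d by simp
  ultimately show ?thesis using \<kappa>(1) by blast
qed

text \<open>In the non-convex case the property holds locally, trivially at interior points and by
  \<open>sublevel_corkscrew\<close> at boundary points, and it survives decreasing both constants. A
  finite subcover of the compact set \<open>X\<close> then allows taking minima.\<close>

lemma admissible_corkscrew:
  fixes X :: "'a::euclidean_space set"
  assumes "admissible_X X"
  shows "\<exists>\<kappa>>0. \<exists>R>0. \<forall>x\<in>X. \<forall>\<rho>. 0 < \<rho> \<and> \<rho> \<le> R \<longrightarrow> (\<exists>y. ball y (\<kappa> * \<rho>) \<subseteq> X \<inter> ball x \<rho>)"
proof (cases "convex X")
  case True
  then show ?thesis using assms unfolding admissible_X_def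
    by (intro convex_corkscrew) (auto simp: compact_imp_bounded)
next
  case False
  then have sm: "smooth_boundary X" and "compact X" using assms by (auto simp: admissible_X_def)
  define Q where "Q = (\<lambda>x \<kappa> R. \<forall>\<rho>. 0 < \<rho> \<and> \<rho> \<le> R \<longrightarrow> (\<exists>y. ball y (\<kappa> * \<rho>) \<subseteq> X \<inter> ball x \<rho>))"
  have mono: "Q x \<kappa>' R'" if Qx: "Q x \<kappa> R" and le: "\<kappa>' \<le> \<kappa>" "R' \<le> R" for x \<kappa> R \<kappa>' R'
    unfolding Q_def
  proof (intro allI impI)
    fix \<rho> assume "0 < \<rho> \<and> \<rho> \<le> R'"
    then have "0 < \<rho> \<and> \<rho> \<le> R" using that by linarith
    then obtain y where y: "ball y (\<kappa> * \<rho>) \<subseteq> X \<inter> ball x \<rho>" using Qx unfolding Q_def by blast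
    have "ball y (\<kappa>' * \<rho>) \<subseteq> ball y (\<kappa> * \<rho>)"
      using that \<open>0 < \<rho> \<and> \<rho> \<le> R'\<close> by (intro subset_ball mult_right_mono) auto
    then show "\<exists>y. ball y (\<kappa>' * \<rho>) \<subseteq> X \<inter> ball x \<rho>" using y by blast
  qed
  have loc: "\<exists>\<delta>>0. \<exists>\<kappa>>0. \<exists>R>0. \<forall>x\<in>X \<inter> ball p \<delta>. Q x \<kappa> R" if p: "p \<in> X" for p
  proof (cases "p \<in> interior X")
    case True
    then obtain e where e: "e > 0" "ball p e \<subseteq> X" by (meson mem_interior)
    have "Q x 1 (e / 2)" if x: "x \<in> X \<inter> ball p (e / 2)" for x
      unfolding Q_def
    proof (intro allI impI)
      fix \<rho> assume \<rho>: "0 < \<rho> \<and> \<rho> \<le> e / 2"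
      have "ball x \<rho> \<subseteq> ball p e"
      proof
        fix z assume "z \<in> ball x \<rho>" then show "z \<in> ball p e"
          using x \<rho> dist_triangle[of p z x] by auto
      qed
      then show "\<exists>y. ball y (1 * \<rho>) \<subseteq> X \<inter> ball x \<rho>" using e by auto
    qed
    moreover have "e / 2 > 0" "(1::real) > 0" using e by auto
    ultimately show ?thesis by blast
  next
    case False
    then have "p \<in> frontier X" using p by (simp add: frontier_def closure_subset[THEN subsetD])
    then obtain U g where U: "open U" "p \<in> U" "smooth_on U g"
      "\<forall>x\<in>U. \<exists>L. (g has_derivative L) (at x) \<and> (\<exists>v. L v \<noteq> 0)" "X \<inter> U = {x \<in> U. g x \<le> 0}"
      using sm unfolding smooth_boundary_def by blast
    then obtain L where L: "\<And>x. x \<in> U \<Longrightarrow> (g has_derivative L x) (at x)" "\<And>x. x \<in> U \<Longrightarrow> \<exists>v. L x v \<noteq> 0"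
      by metis
    then obtain v where "L p v \<noteq> 0" using U by blast
    from sublevel_corkscrew[OF U(1-3) L(1) this U(5)] show ?thesis unfolding Q_def .
  qed
  then obtain \<delta> \<kappa> R where *: "\<And>p. p \<in> X \<Longrightarrow> \<delta> p > 0" "\<And>p. p \<in> X \<Longrightarrow> \<kappa> p > 0" "\<And>p. p \<in> X \<Longrightarrow> R p > 0"
    "\<And>p x. p \<in> X \<Longrightarrow> x \<in> X \<inter> ball p (\<delta> p) \<Longrightarrow> Q x (\<kappa> p) (R p)" by metis
  have "X \<subseteq> (\<Union>p\<in>X. ball p (\<delta> p))" using * by auto
  then obtain F where F: "F \<subseteq> X" "finite F" "X \<subseteq> (\<Union>p\<in>F. ball p (\<delta> p))"
    using compactE_image[OF \<open>compact X\<close>, of X "\<lambda>p. ball p (\<delta> p)"] by auto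
  define k where "k = Min (insert 1 (\<kappa> ` F))"
  define r where "r = Min (insert 1 (R ` F))"
  have "k > 0" "r > 0" using F * by (auto simp: k_def r_def subset_eq)
  moreover have "Q x k r" if xX: "x \<in> X" for x
  proof -
    obtain p where p: "p \<in> F" "x \<in> ball p (\<delta> p)" using F xX by blast
    have "Q x (\<kappa> p) (R p)" using *(4)[of p x] p F xX by blast
    moreover have "k \<le> \<kappa> p" "r \<le> R p" using p F by (auto simp: k_def r_def)
    ultimately show ?thesis using mono by blast
  qed
  ultimately show ?thesis unfolding Q_def by blast
qed

section \<open>Packing\<close>

lemma comp_seg_add: "comp_seg \<phi> w k (m + n) = comp_seg \<phi> w k m \<circ> comp_seg \<phi> w (k + m) n"
  by (induction n) (simp_all add: fun_eq_iff add.assoc)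

lemma comp_seg_cong:
  "(\<And>j. k \<le> j \<Longrightarrow> j < k + n \<Longrightarrow> w j = w' j) \<Longrightarrow> comp_seg \<phi> w k n = comp_seg \<phi> w' k n"
  by (induction n) (simp_all add: fun_eq_iff)

text \<open>Compare Lebesgue measures; the common factor \<open>unit_ball_vol\<close>
  cancels.\<close>

lemma sum_content_disjoint_balls_le:
  fixes z :: "'s \<Rightarrow> 'a::euclidean_space"
  assumes "finite S" "\<And>i. i \<in> S \<Longrightarrow> 0 \<le> \<rho> i" "0 \<le> r"
    and sub: "\<And>i. i \<in> S \<Longrightarrow> ball (z i) (\<rho> i) \<subseteq> ball x r"
    and disj: "\<And>i j. i \<in> S \<Longrightarrow> j \<in> S \<Longrightarrow> i \<noteq> j \<Longrightarrow> ball (z i) (\<rho> i) \<inter> ball (z j) (\<rho> j) = {}"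
  shows "(\<Sum>i\<in>S. \<rho> i ^ DIM('a)) \<le> r ^ DIM('a)"
proof -
  let ?c = "unit_ball_vol (real DIM('a))"
  have "(\<Sum>i\<in>S. ?c * \<rho> i ^ DIM('a)) = (\<Sum>i\<in>S. measure lborel (ball (z i) (\<rho> i)))"
    using assms by (intro sum.cong) (auto simp: content_ball)
  also have "\<dots> = measure lborel (\<Union>i\<in>S. ball (z i) (\<rho> i))"
    using assms by (intro measure_UNION'[symmetric]) (auto simp: pairwise_def disjnt_def fmeasurable_def emeasure_bounded_finite[simplified])
  also have "\<dots> \<le> measure lborel (ball x r)"
    using sub assms(1) by (intro measure_mono_fmeasurable) (auto simp: fmeasurable_def emeasure_bounded_finite[simplified])
  also have "\<dots> = ?c * r ^ DIM('a)" using assms by (simp add: content_ball)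
  finally show ?thesis by (simp flip: sum_distrib_left)
qed

section \<open>Maps of bounded distortion and the packing bound\<close>

text \<open>Collects what is used about a composition as a property of one map, so that letters,
  words and inner segments of words are treated alike, with the same \<open>K\<close>.\<close>

definition bd_conformal :: "real \<Rightarrow> 'a::euclidean_space set \<Rightarrow> 'a set \<Rightarrow> ('a \<Rightarrow> 'a) \<Rightarrow> bool" where
  "bd_conformal K V X f \<longleftrightarrow> f ` V \<subseteq> V \<and> f ` X \<subseteq> X \<and> inj_on f V \<and> (\<forall>x\<in>V. conformal_at f x) \<and>
     (\<forall>x\<in>V. \<forall>y\<in>V. dscale f x \<le> K * dscale f y)"

locale bd_domain =
  fixes X V :: "'a::euclidean_space set" and K :: real
  assumes nonempty: "X \<noteq> {}" and XV: "X \<subseteq> V" and K1: "K \<ge> 1"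
begin

lemma XVD: "x \<in> X \<Longrightarrow> x \<in> V" using XV by blast

abbreviation "tame \<equiv> bd_conformal K V X"

lemma dscale_le_normD:
  assumes "tame f" "x \<in> X"
  shows "dscale f x \<le> normD f X"
proof -
  have "bdd_above (dscale f ` X)"
    using assms XVD unfolding bd_conformal_def by (intro bdd_aboveI[of _ "K * dscale f x"]) auto
  then show ?thesis unfolding normD_def using assms by (intro cSUP_upper)
qed

lemma normD_le:
  assumes "\<And>x. x \<in> X \<Longrightarrow> dscale f x \<le> c" shows "normD f X \<le> c"
  unfolding normD_def using assms nonempty by (intro cSUP_least)

lemma normD_le_dscale:
  assumes "tame f" "y \<in> V" shows "normD f X \<le> K * dscale f y"
  using assms XV by (intro normD_le) (auto simp: bd_conformal_def)

lemma dscale_pos: "tame f \<Longrightarrow> x \<in> V \<Longrightarrow> dscale f x > 0"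
  by (auto simp: bd_conformal_def intro: conformal_at_dscale(2))

lemma normD_pos:
  assumes "tame f" shows "normD f X > 0"
proof -
  obtain x where "x \<in> X" using nonempty by blast
  then show ?thesis using dscale_pos[of f x] dscale_le_normD[of f x] assms XV by fastforce
qed

lemma dscale_compose:
  assumes "tame f" "tame g" "x \<in> V"
  shows "dscale (f \<circ> g) x = dscale f (g x) * dscale g x"
  using assms by (intro conformal_at_compose(2)) (auto simp: bd_conformal_def)

lemma normD_compose_le:
  assumes f: "tame f" and g: "tame g"
  shows "normD (f \<circ> g) X \<le> normD f X * normD g X"
proof (rule normD_le)
  fix x assume x: "x \<in> X"
  then have gx: "g x \<in> X" using g by (auto simp: bd_conformal_def)
  then show "dscale (f \<circ> g) x \<le> normD f X * normD g X"
    using dscale_compose[OF f g, of x] dscale_le_normD[OF f gx] dscale_le_normD[OF g x]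
      dscale_pos[OF f, of "g x"] dscale_pos[OF g, of x] XVD[OF x] XVD[OF gx]
    by (auto intro!: mult_mono)
qed

text \<open>Together with \<open>normD_compose_le\<close> this makes \<open>normD\<close>
  multiplicative up to \<open>K\<close>: by bounded distortion, replacing
  \<open>dscale f (g x)\<close> by the supremum of \<open>dscale f\<close> costs at most the factor
  \<open>K\<close>.\<close>

lemma normD_compose_ge:
  assumes f: "tame f" and g: "tame g" and fg: "tame (f \<circ> g)"
  shows "normD f X * normD g X \<le> K * normD (f \<circ> g) X"
proof -
  have "normD g X \<le> K * normD (f \<circ> g) X / normD f X"
  proof (rule normD_le)
    fix x assume x: "x \<in> X"
    then have gx: "g x \<in> V" using g XV by (auto simp: bd_conformal_def)
    have "normD f X * dscale g x \<le> K * dscale f (g x) * dscale g x"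
      using normD_le_dscale[OF f gx] dscale_pos[OF g, of x] x XV by (intro mult_right_mono) auto
    also have "\<dots> = K * dscale (f \<circ> g) x" using dscale_compose[OF f g, of x] x XV by auto
    also have "\<dots> \<le> K * normD (f \<circ> g) X" using dscale_le_normD[OF fg x] K1 by (intro mult_left_mono) auto
    finally show "dscale g x \<le> K * normD (f \<circ> g) X / normD f X"
      using normD_pos[OF f] by (simp add: field_simps)
  qed
  then show ?thesis using normD_pos[OF f] by (simp add: field_simps)
qed

lemma tame_continuous: "tame f \<Longrightarrow> continuous_on V f"
  by (meson bd_conformal_def conformal_at_dscale(3) continuous_at_imp_continuous_on has_derivative_continuous)

text \<open>By invariance of domain the image is open, hence inside the interior. This lets
  disjointness at one letter pass to all longer words.\<close>

lemma tame_interior: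
  assumes "tame f" shows "f ` interior X \<subseteq> interior X"
proof (rule interior_maximal)
  show "f ` interior X \<subseteq> X" using assms interior_subset by (fastforce simp: bd_conformal_def)
  have "interior X \<subseteq> V" using XV interior_subset by blast
  moreover have "inj_on f V" using assms by (simp add: bd_conformal_def)
  ultimately show "open (f ` interior X)"
    by (intro invariance_of_domain continuous_on_subset[OF tame_continuous[OF assms]] open_interior)
      (auto intro: inj_on_subset)
qed

lemma tame_id: "tame id"
proof -
  have "dscale id x = 1" "conformal_at id x" for x :: 'a
    by (auto simp: dscale_def conformal_at_def id_def frechet_derivative_id onorm_id intro!: exI[of _ 1])
  then show ?thesis using K1 by (auto simp: bd_conformal_def)
qed

lemma normD_id: "normD id X = 1"
proof -
  have "dscale id x = 1" for x :: 'a by (auto simp: dscale_def id_def frechet_derivative_id onorm_id)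
  then show ?thesis using nonempty by (simp add: normD_def)
qed

end

text \<open>\<open>ballV\<close> ties \<open>R\<close> to the neighbourhood \<open>V\<close>, so
  that derivative bounds can be integrated over balls around points of \<open>X\<close> that may
  leave \<open>X\<close>.\<close>

locale corkscrew_domain = bd_domain +
  fixes \<kappa> R :: real
  assumes \<kappa>_pos: "\<kappa> > 0" and R_pos: "R > 0"
    and corkscrew: "x \<in> X \<Longrightarrow> 0 < \<rho> \<Longrightarrow> \<rho> \<le> R \<Longrightarrow> \<exists>y. ball y (\<kappa> * \<rho>) \<subseteq> X \<inter> ball x \<rho>"
    and ballV: "x \<in> X \<Longrightarrow> ball x R \<subseteq> V"
begin

text \<open>Push a corkscrew ball near \<open>p\<close> forward. Its image contains a ball because
  \<open>dscale f\<close> is at least \<open>normD f X / K\<close> on \<open>V\<close>, and it stays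
  close to \<open>f p\<close> by the mean value inequality on \<open>ball p \<rho>\<close>, where
  the derivative is at most \<open>K * normD f X\<close>.\<close>

lemma tame_image_contains_ball:
  assumes f: "tame f" and p: "p \<in> X" and \<rho>: "0 < \<rho>" "\<rho> \<le> R"
  shows "\<exists>z. ball z (\<kappa> / K * \<rho> * normD f X) \<subseteq> f ` interior X \<inter> ball (f p) (K * \<rho> * normD f X)"
proof -
  obtain y where y: "ball y (\<kappa> * \<rho>) \<subseteq> X \<inter> ball p \<rho>" using corkscrew[OF p \<rho>] by blast
  then have yint: "ball y (\<kappa> * \<rho>) \<subseteq> interior X" by (simp add: interior_maximal)
  have pos: "0 < normD f X" using normD_pos[OF f] .
  have "ball (f y) (normD f X / K * (\<kappa> * \<rho>)) \<subseteq> f ` ball y (\<kappa> * \<rho>)"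
  proof (rule ball_subset_conformal_image)
    have yV: "ball y (\<kappa> * \<rho>) \<subseteq> V" using y XV by blast
    then show "inj_on f (ball y (\<kappa> * \<rho>))" using f by (meson bd_conformal_def inj_on_subset)
    show "conformal_at f x" if "x \<in> ball y (\<kappa> * \<rho>)" for x using f yV that unfolding bd_conformal_def by blast
    show "normD f X / K \<le> dscale f x" if "x \<in> ball y (\<kappa> * \<rho>)" for x
      using normD_le_dscale[OF f, of x] subsetD[OF yV that] K1 by (auto simp: field_simps)
  qed (use pos K1 \<kappa>_pos \<rho> in auto)
  moreover have "f ` ball y (\<kappa> * \<rho>) \<subseteq> ball (f p) (K * \<rho> * normD f X)"
  proof
    fix u assume "u \<in> f ` ball y (\<kappa> * \<rho>)"
    then obtain q where q: "q \<in> ball p \<rho>" "u = f q" using y by blast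
    have sub: "ball p \<rho> \<subseteq> V" using ballV[OF p] \<rho> by auto
    have "norm (f q - f p) \<le> (K * normD f X) * norm (q - p)"
    proof (rule differentiable_bound[where S="ball p \<rho>" and f'="\<lambda>x. frechet_derivative f (at x)"])
      fix x assume x: "x \<in> ball p \<rho>"
      then have xV: "x \<in> V" using sub by blast
      then show "(f has_derivative frechet_derivative f (at x)) (at x within ball p \<rho>)"
        using f by (auto simp: bd_conformal_def intro: has_derivative_at_withinI[OF conformal_at_dscale(3)])
      have "dscale f x \<le> K * dscale f p" using f xV p XV by (auto simp: bd_conformal_def)
      also have "\<dots> \<le> K * normD f X" using dscale_le_normD[OF f p] K1 by (intro mult_left_mono) auto
      finally show "onorm (frechet_derivative f (at x)) \<le> K * normD f X" by (simp add: dscale_def)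
    qed (use q \<rho> in auto)
    also have "\<dots> < (K * normD f X) * \<rho>"
      using q pos K1 by (intro mult_strict_left_mono) (auto simp: dist_norm norm_minus_commute)
    finally show "u \<in> ball (f p) (K * \<rho> * normD f X)"
      using q by (simp add: dist_norm norm_minus_commute mult_ac)
  qed
  moreover have "normD f X / K * (\<kappa> * \<rho>) = \<kappa> / K * \<rho> * normD f X" by simp
  ultimately have "ball (f y) (\<kappa> / K * \<rho> * normD f X) \<subseteq> f ` interior X \<inter> ball (f p) (K * \<rho> * normD f X)"
    using image_mono[OF yint, of f] by (auto simp only: le_inf_iff intro: order_trans)
  then show ?thesis by blast
qed

text \<open>The \<open>d\<close>-th power of a quotient of radii: in \<open>packing\<close> all
  balls lie in one of radius \<open>(1 + K * R) * r\<close>, and each has radius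
  \<open>\<kappa> * R / K\<close> times its scale truncated at \<open>r\<close>.\<close>

definition "packC = ((1 + K * R) * K / (\<kappa> * R)) ^ DIM('a)"

lemma packC_pos: "packC > 0"
  unfolding packC_def using K1 \<kappa>_pos R_pos by (auto intro!: zero_less_power divide_pos_pos mult_pos_pos add_pos_pos)

text \<open>Every image meeting \<open>ball x r\<close> contains a ball comparable to its scale
  truncated at \<open>r\<close>, inside a fixed multiple of \<open>ball x r\<close>; these balls are
  disjoint, so their volumes add up. The truncation serves two uses: maps of scale at most
  \<open>r\<close> have their \<open>d\<close>-th powers summed, maps of larger scale are
  counted.\<close>

lemma packing:
  assumes "finite S" and tame: "\<And>i. i \<in> S \<Longrightarrow> tame (f i)" and "r > 0"
    and hit: "\<And>i. i \<in> S \<Longrightarrow> f i ` X \<inter> ball x r \<noteq> {}"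
    and disj: "\<And>i j. i \<in> S \<Longrightarrow> j \<in> S \<Longrightarrow> i \<noteq> j \<Longrightarrow> f i ` interior X \<inter> f j ` interior X = {}"
  shows "(\<Sum>i\<in>S. min (normD (f i) X) r ^ DIM('a)) \<le> packC * r ^ DIM('a)"
proof -
  define a where "a = (\<lambda>i. min (normD (f i) X) r)"
  have a: "0 < a i" "a i \<le> r" if "i \<in> S" for i
    using normD_pos[OF tame[OF that]] \<open>r > 0\<close> by (auto simp: a_def)
  have "\<exists>z. ball z (\<kappa> * R / K * a i) \<subseteq> f i ` interior X \<inter> ball x ((1 + K * R) * r)" if i: "i \<in> S" for i
  proof -
    have pos: "normD (f i) X > 0" using normD_pos[OF tame[OF i]] .
    obtain p where p: "p \<in> X" "dist x (f i p) < r" using hit[OF i] by auto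
    \<comment> \<open>Chosen so that \<open>\<rho> * normD (f i) X = R * a i\<close>: of a large
      image only a piece of size about \<open>r\<close> near the hitting point is used.\<close>
    define \<rho> where "\<rho> = R * a i / normD (f i) X"
    have "\<rho> > 0" using a[OF i] pos R_pos by (simp add: \<rho>_def)
    have "a i \<le> normD (f i) X" by (simp add: a_def)
    then have "\<rho> \<le> R" using pos R_pos by (simp add: \<rho>_def field_simps)
    have \<rho>n: "\<rho> * normD (f i) X = R * a i" using pos by (simp add: \<rho>_def)
    obtain z where z: "ball z (\<kappa> / K * \<rho> * normD (f i) X) \<subseteq> f i ` interior X \<inter> ball (f i p) (K * \<rho> * normD (f i) X)"
      using tame_image_contains_ball[OF tame[OF i] p(1) \<open>\<rho> > 0\<close> \<open>\<rho> \<le> R\<close>] by blast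
    have e: "\<kappa> / K * \<rho> * normD (f i) X = \<kappa> * R / K * a i" "K * \<rho> * normD (f i) X = K * (R * a i)"
      using \<rho>n by (simp_all add: mult.assoc)
    have "ball (f i p) (K * \<rho> * normD (f i) X) \<subseteq> ball x ((1 + K * R) * r)"
    proof
      fix u assume "u \<in> ball (f i p) (K * \<rho> * normD (f i) X)"
      then have "dist (f i p) u < K * (R * a i)" by (simp add: e)
      also have "\<dots> \<le> K * (R * r)" using a[OF i] K1 R_pos by (intro mult_left_mono) auto
      finally have "dist x u < r + K * (R * r)" using p dist_triangle[of x u "f i p"] by linarith
      then show "u \<in> ball x ((1 + K * R) * r)" by (simp add: algebra_simps)
    qed
    then show ?thesis using z unfolding e(1) by blast
  qed
  then obtain z where z: "\<And>i. i \<in> S \<Longrightarrow> ball (z i) (\<kappa> * R / K * a i) \<subseteq> f i ` interior X \<inter> ball x ((1 + K * R) * r)"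
    by metis
  have "(\<Sum>i\<in>S. (\<kappa> * R / K * a i) ^ DIM('a)) \<le> ((1 + K * R) * r) ^ DIM('a)"
  proof (rule sum_content_disjoint_balls_le)
    show "ball (z i) (\<kappa> * R / K * a i) \<subseteq> ball x ((1 + K * R) * r)" if "i \<in> S" for i using z[OF that] by blast
    show "ball (z i) (\<kappa> * R / K * a i) \<inter> ball (z j) (\<kappa> * R / K * a j) = {}"
      if "i \<in> S" "j \<in> S" "i \<noteq> j" for i j using z[OF that(1)] z[OF that(2)] disj[OF that] by blast
    show "0 \<le> \<kappa> * R / K * a i" if "i \<in> S" for i using a[OF that] \<kappa>_pos R_pos K1 by auto
    show "0 \<le> (1 + K * R) * r" using \<open>r > 0\<close> R_pos K1 by auto
  qed (rule \<open>finite S\<close>)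
  then have *: "(\<kappa> * R / K) ^ DIM('a) * (\<Sum>i\<in>S. a i ^ DIM('a)) \<le> (1 + K * R) ^ DIM('a) * r ^ DIM('a)"
    by (simp only: power_mult_distrib sum_distrib_left)
  have c: "(\<kappa> * R / K) ^ DIM('a) > 0" using \<kappa>_pos R_pos K1 by auto
  have "packC * (\<kappa> * R / K) ^ DIM('a) = (1 + K * R) ^ DIM('a)"
    unfolding packC_def power_mult_distrib[symmetric] using \<kappa>_pos R_pos K1 by simp
  then have "(\<kappa> * R / K) ^ DIM('a) * (\<Sum>i\<in>S. a i ^ DIM('a)) \<le> (\<kappa> * R / K) ^ DIM('a) * (packC * r ^ DIM('a))"
    using * by (simp add: mult_ac)
  then show ?thesis using c by (simp add: a_def)
qed

end

section \<open>Words and their scales\<close>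

locale finite_ncifs = corkscrew_domain X V K \<kappa> R
  for X V :: "'a::euclidean_space set" and K \<kappa> R :: real +
  fixes I :: "nat \<Rightarrow> 'i set" and \<phi> :: "nat \<Rightarrow> 'i \<Rightarrow> 'a \<Rightarrow> 'a" and \<eta> :: real
  assumes I_nonempty: "j \<ge> 1 \<Longrightarrow> I j \<noteq> {}" and I_finite: "j \<ge> 1 \<Longrightarrow> finite (I j)"
    and tame_seg: "1 \<le> k \<Longrightarrow> (\<And>j. k \<le> j \<Longrightarrow> j < k + n \<Longrightarrow> w j \<in> I j) \<Longrightarrow> tame (comp_seg \<phi> w k n)"
    and osc: "j \<ge> 1 \<Longrightarrow> a \<in> I j \<Longrightarrow> b \<in> I j \<Longrightarrow> a \<noteq> b \<Longrightarrow> \<phi> j a ` interior X \<inter> \<phi> j b ` interior X = {}"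
    and \<eta>1: "\<eta> < 1" and contraction: "j \<ge> 1 \<Longrightarrow> i \<in> I j \<Longrightarrow> normD (\<phi> j i) X \<le> \<eta>"
    and compactX: "compact X"
begin

text \<open>Unlike membership in \<open>words\<close>, this leaves \<open>w\<close> free outside
  \<open>{1..n}\<close>, so the prefixes of a long word can be measured without restricting
  it.\<close>

definition valid :: "nat \<Rightarrow> (nat \<Rightarrow> 'i) \<Rightarrow> bool" where
  "valid n w \<longleftrightarrow> (\<forall>j. 1 \<le> j \<and> j \<le> n \<longrightarrow> w j \<in> I j)"

definition wscale :: "nat \<Rightarrow> (nat \<Rightarrow> 'i) \<Rightarrow> real" where
  "wscale n w = normD (comp_seg \<phi> w 1 n) X"

abbreviation "letter j i \<equiv> normD (\<phi> j i) X"

abbreviation "Z n t \<equiv> Zfun X I \<phi> n t"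

lemma valid_words: "w \<in> words I n \<Longrightarrow> valid n w"
  by (auto simp: words_def valid_def PiE_def Pi_def)

lemma valid_mono: "valid n w \<Longrightarrow> m \<le> n \<Longrightarrow> valid m w"
  by (auto simp: valid_def)

lemma finite_words: "finite (words I n)"
  unfolding words_def by (intro finite_PiE) (auto intro: I_finite)

lemma words_nonempty: "words I n \<noteq> {}"
  unfolding words_def using I_nonempty by (auto simp: PiE_eq_empty_iff)

lemma restrict_words: "u \<in> words I n \<Longrightarrow> m \<le> n \<Longrightarrow> restrict u {1..m} \<in> words I m"
  by (auto simp: words_def PiE_def Pi_def)

lemma upd_words: "v \<in> words I k \<Longrightarrow> a \<in> I (Suc k) \<Longrightarrow> v(Suc k := a) \<in> words I (Suc k)"
  by (auto simp: words_def PiE_def Pi_def extensional_def)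

lemma tame_comp: "valid n w \<Longrightarrow> tame (comp_seg \<phi> w 1 n)"
  by (intro tame_seg) (auto simp: valid_def)

lemma tame_letter: "j \<ge> 1 \<Longrightarrow> i \<in> I j \<Longrightarrow> tame (\<phi> j i)"
  using tame_seg[of j 1 "\<lambda>_. i"] by (simp add: le_less_Suc_eq)

lemma letter_pos: "j \<ge> 1 \<Longrightarrow> i \<in> I j \<Longrightarrow> letter j i > 0"
  by (intro normD_pos tame_letter)

lemma \<eta>_pos: "\<eta> > 0"
proof -
  obtain i where "i \<in> I 1" using I_nonempty[of 1] by auto
  then show ?thesis using letter_pos[of 1 i] contraction[of 1 i] by simp
qed

lemma wscale_cong: "(\<And>j. 1 \<le> j \<Longrightarrow> j \<le> n \<Longrightarrow> w j = w' j) \<Longrightarrow> wscale n w = wscale n w'"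
  unfolding wscale_def using comp_seg_cong[of 1 n w w' \<phi>] by auto

lemma wscale_0: "wscale 0 w = 1"
  by (simp add: wscale_def normD_id)

lemma wscale_pos: "valid n w \<Longrightarrow> wscale n w > 0"
  unfolding wscale_def by (intro normD_pos tame_comp)

lemma wscale_Suc_le:
  assumes "valid (Suc n) w"
  shows "wscale (Suc n) w \<le> wscale n w * letter (Suc n) (w (Suc n))"
proof -
  have "tame (comp_seg \<phi> w 1 n)" by (rule tame_comp[OF valid_mono[OF assms]]) simp
  moreover have "tame (\<phi> (Suc n) (w (Suc n)))"
    using assms by (intro tame_letter) (auto simp: valid_def)
  ultimately show ?thesis using normD_compose_le by (simp add: wscale_def)
qed

lemma wscale_Suc_ge:
  assumes "valid (Suc n) w"
  shows "wscale n w * letter (Suc n) (w (Suc n)) \<le> K * wscale (Suc n) w"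
proof -
  have "tame (comp_seg \<phi> w 1 n)" by (rule tame_comp[OF valid_mono[OF assms]]) simp
  moreover have "tame (\<phi> (Suc n) (w (Suc n)))"
    using assms by (intro tame_letter) (auto simp: valid_def)
  moreover have "tame (comp_seg \<phi> w 1 n \<circ> \<phi> (Suc n) (w (Suc n)))"
    using tame_comp[OF assms] by simp
  ultimately show ?thesis using normD_compose_ge by (simp add: wscale_def)
qed

lemma wscale_add_le: "valid (m + k) w \<Longrightarrow> wscale (m + k) w \<le> \<eta> ^ k * wscale m w"
proof (induction k)
  case (Suc k)
  then have v: "valid (m + k) w" by (auto intro: valid_mono)
  have "wscale (m + Suc k) w \<le> wscale (m + k) w * letter (Suc (m + k)) (w (Suc (m + k)))"
    using wscale_Suc_le Suc.prems by simp
  also have "\<dots> \<le> (\<eta> ^ k * wscale m w) * \<eta>"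
    using Suc v wscale_pos[of "m + k" w] contraction letter_pos[of "Suc (m + k)" "w (Suc (m + k))"]
      wscale_pos[of m w] valid_mono[OF v, of m] \<eta>_pos
    by (intro mult_mono) (auto simp: valid_def)
  finally show ?case by (simp add: mult_ac)
qed simp

lemma wscale_le: "valid n w \<Longrightarrow> wscale n w \<le> \<eta> ^ n"
  using wscale_add_le[of 0 n w] by (simp add: wscale_0)

section \<open>Exchanging prefixes, cylinder masses and disjoint images\<close>

text \<open>Both words end with the same segment \<open>?h\<close>. Submultiplicativity bounds the
  scale of \<open>u\<close> from above and quasi-multiplicativity that of \<open>v\<close> from
  below, so the factor \<open>normD ?h X\<close> cancels at the cost of a single
  \<open>K\<close>.\<close>

lemma wscale_exchange:
  assumes u: "valid n u" and v: "valid n v" and eq: "\<And>j. m < j \<Longrightarrow> j \<le> n \<Longrightarrow> u j = v j" and "m \<le> n"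
  shows "wscale n u * wscale m v \<le> K * (wscale m u * wscale n v)"
proof -
  let ?h = "comp_seg \<phi> u (1 + m) (n - m)"
  have h: "?h = comp_seg \<phi> v (1 + m) (n - m)" using eq \<open>m \<le> n\<close> by (intro comp_seg_cong) auto
  have U: "comp_seg \<phi> u 1 n = comp_seg \<phi> u 1 m \<circ> ?h"
    using comp_seg_add[of \<phi> u 1 m "n - m"] \<open>m \<le> n\<close> by simp
  have W: "comp_seg \<phi> v 1 n = comp_seg \<phi> v 1 m \<circ> ?h"
    unfolding h using comp_seg_add[of \<phi> v 1 m "n - m"] \<open>m \<le> n\<close> by simp
  have th: "tame ?h" using u \<open>m \<le> n\<close> by (intro tame_seg) (auto simp: valid_def)
  have tm: "tame (comp_seg \<phi> u 1 m)" "tame (comp_seg \<phi> v 1 m)"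
    using u v valid_mono[OF _ \<open>m \<le> n\<close>] tame_comp by blast+
  have "wscale n u \<le> wscale m u * normD ?h X" unfolding wscale_def U using tm th by (intro normD_compose_le)
  then have "wscale n u * wscale m v \<le> (wscale m u * normD ?h X) * wscale m v"
    using wscale_pos[OF valid_mono[OF v \<open>m \<le> n\<close>]] by (intro mult_right_mono) auto
  also have "\<dots> = wscale m u * (wscale m v * normD ?h X)" by simp
  also have "\<dots> \<le> wscale m u * (K * wscale n v)"
  proof (intro mult_left_mono)
    show "wscale m v * normD ?h X \<le> K * wscale n v"
      unfolding wscale_def W using tm th tame_comp[OF v] unfolding W by (intro normD_compose_ge)
  qed (use wscale_pos[OF valid_mono[OF u \<open>m \<le> n\<close>]] in auto)
  finally show ?thesis by (simp add: mult_ac)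
qed

lemma Z_eq: "Z n t = (\<Sum>w\<in>words I n. wscale n w powr t)"
proof (cases "n = 0")
  case True
  then show ?thesis by (simp add: Zfun_def words_def wscale_0)
qed (simp add: Zfun_def wscale_def)

lemma Z_pos: "Z n t > 0"
  unfolding Z_eq using wscale_pos[OF valid_words] finite_words words_nonempty
  by (intro sum_pos) (auto simp: less_imp_neq[symmetric])

text \<open>A Gibbs-type bound: the cylinder of \<open>w\<close> carries at most the fraction
  \<open>K powr t * wscale m w powr t / Z m t\<close> of the total weight. Replacing the prefix
  \<open>w\<close> by every \<open>v\<close> in turn embeds the cylinder times
  \<open>words I m\<close> into \<open>words I n\<close>, and \<open>wscale_exchange\<close>
  compares weights along this embedding.\<close>

lemma cylinder_sum_le:
  assumes "t \<ge> 0" "m \<le> n" and w: "w \<in> words I m"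
  shows "(\<Sum>u\<in>{u\<in>words I n. restrict u {1..m} = w}. wscale n u powr t) * Z m t
           \<le> K powr t * wscale m w powr t * Z n t"
proof -
  let ?C = "{u\<in>words I n. restrict u {1..m} = w}"
  \<comment> \<open>Keeps the tail of \<open>u\<close> and takes its first \<open>m\<close> letters
    from \<open>v\<close>. Nothing is lost, since the prefix of \<open>u\<close> is known to be
    \<open>w\<close>.\<close>
  define cat where "cat = (\<lambda>(u, v :: nat \<Rightarrow> 'i) j. if j \<le> m then v j else u j)"
  have fin: "finite ?C" using finite_words by auto
  have cat: "cat (u, v) \<in> words I n" if "u \<in> ?C" "v \<in> words I m" for u v
    using that \<open>m \<le> n\<close> by (auto simp: cat_def words_def PiE_def Pi_def extensional_def)
  have inj: "inj_on cat (?C \<times> words I m)"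
  proof (rule inj_onI, clarify)
    fix u v u' v' assume u: "u \<in> words I n" "u' \<in> words I n" "restrict u' {1..m} = restrict u {1..m}"
      and v: "v \<in> words I m" "v' \<in> words I m" and eq: "cat (u, v) = cat (u', v')"
    have "v j = v' j" for j
      using fun_cong[OF eq, of j] v by (cases "j \<le> m") (auto simp: cat_def words_def PiE_def extensional_def)
    moreover have "u j = u' j" for j
    proof (cases "j \<le> m")
      case True
      show ?thesis
      proof (cases "j = 0")
        case True then show ?thesis using u by (auto simp: words_def PiE_def extensional_def)
      next
        case False then show ?thesis using fun_cong[OF u(3), of j] \<open>j \<le> m\<close> by simp
      qed
    qed (use fun_cong[OF eq, of j] in \<open>auto simp: cat_def\<close>)
    ultimately show "u = u' \<and> v = v'" by auto
  qed
  have le: "wscale n u powr t * wscale m v powr t \<le> K powr t * wscale m w powr t * wscale n (cat (u, v)) powr t"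
    if "u \<in> ?C" "v \<in> words I m" for u v
  proof -
    have val: "valid n u" "valid n (cat (u, v))" "valid m v" using valid_words cat that by auto
    have "wscale m (cat (u, v)) = wscale m v" by (intro wscale_cong) (simp add: cat_def)
    moreover have "wscale m u = wscale m w" using that by (intro wscale_cong) auto
    ultimately have "wscale n u * wscale m v \<le> K * (wscale m w * wscale n (cat (u, v)))"
      using wscale_exchange[OF val(1,2) _ \<open>m \<le> n\<close>] by (auto simp: cat_def)
    then have "(wscale n u * wscale m v) powr t \<le> (K * (wscale m w * wscale n (cat (u, v)))) powr t"
      using \<open>t \<ge> 0\<close> wscale_pos[OF val(1)] wscale_pos[OF val(3)] by (intro powr_mono2) auto
    then show ?thesis
      using wscale_pos[OF val(1)] wscale_pos[OF val(2)] wscale_pos[OF val(3)] wscale_pos[OF valid_words[OF w]] K1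
      by (simp add: powr_mult mult.assoc)
  qed
  have "(\<Sum>u\<in>?C. wscale n u powr t) * Z m t = (\<Sum>(u, v)\<in>?C \<times> words I m. wscale n u powr t * wscale m v powr t)"
    unfolding Z_eq sum_product sum.cartesian_product ..
  also have "\<dots> \<le> (\<Sum>p\<in>?C \<times> words I m. K powr t * wscale m w powr t * wscale n (cat p) powr t)"
    using le by (intro sum_mono) auto
  also have "\<dots> = K powr t * wscale m w powr t * (\<Sum>x\<in>cat ` (?C \<times> words I m). wscale n x powr t)"
    unfolding sum.reindex[OF inj] sum_distrib_left by simp
  also have "\<dots> \<le> K powr t * wscale m w powr t * Z n t"
    unfolding Z_eq using cat finite_words by (intro mult_left_mono sum_mono2) auto
  finally show ?thesis .
qed

text \<open>Each child of \<open>v\<close> has scale at least \<open>wscale k v * c / K\<close>.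
  This trades the \<open>Z (Suc k) t\<close> produced by \<open>cylinder_sum_le\<close> for the
  \<open>Z k t\<close> of the hypothesis of the theorem.\<close>

lemma Z_Suc_ge:
  assumes "t \<ge> 0" and c: "\<And>a. a \<in> I (Suc k) \<Longrightarrow> c \<le> letter (Suc k) a" and "c > 0"
  shows "Z k t * real (card (I (Suc k))) * c powr t \<le> K powr t * Z (Suc k) t"
proof -
  let ?e = "\<lambda>(v, a). v(Suc k := a)"
  have inj: "inj_on ?e (words I k \<times> I (Suc k))"
  proof (rule inj_onI, clarify)
    fix v a v' a' assume v: "v \<in> words I k" "v' \<in> words I k" and eq: "v(Suc k := a) = v'(Suc k := a')"
    have "v j = v' j" for j
      using fun_cong[OF eq, of j] v by (cases "j = Suc k") (auto simp: words_def PiE_def extensional_def)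
    then show "v = v' \<and> a = a'" using fun_cong[OF eq, of "Suc k"] by auto
  qed
  have le: "wscale k v powr t * c powr t \<le> K powr t * wscale (Suc k) (v(Suc k := a)) powr t"
    if "v \<in> words I k" "a \<in> I (Suc k)" for v a
  proof -
    have val: "valid (Suc k) (v(Suc k := a))" "valid k v" using upd_words valid_words that by auto
    have sc: "wscale k (v(Suc k := a)) = wscale k v" by (intro wscale_cong) auto
    have "wscale k v * c \<le> wscale k v * letter (Suc k) a"
      using c[OF that(2)] wscale_pos[OF val(2)] by (intro mult_left_mono) auto
    also have "\<dots> \<le> K * wscale (Suc k) (v(Suc k := a))"
      using wscale_Suc_ge[OF val(1)] by (simp add: sc)
    finally have "wscale k v * c \<le> K * wscale (Suc k) (v(Suc k := a))" by (simp add: sc)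
    then have "(wscale k v * c) powr t \<le> (K * wscale (Suc k) (v(Suc k := a))) powr t"
      using \<open>t \<ge> 0\<close> \<open>c > 0\<close> wscale_pos[OF val(2)] by (intro powr_mono2) auto
    then show ?thesis using K1 wscale_pos[OF val(1)] wscale_pos[OF val(2)] \<open>c > 0\<close> by (simp add: powr_mult)
  qed
  have "Z k t * real (card (I (Suc k))) * c powr t = (\<Sum>v\<in>words I k. \<Sum>a\<in>I (Suc k). wscale k v powr t * c powr t)"
    unfolding Z_eq sum_constant sum_distrib_right by (intro sum.cong) auto
  also have "\<dots> = (\<Sum>(v, a)\<in>words I k \<times> I (Suc k). wscale k v powr t * c powr t)"
    by (rule sum.cartesian_product)
  also have "\<dots> \<le> (\<Sum>p\<in>words I k \<times> I (Suc k). K powr t * wscale (Suc k) (?e p) powr t)"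
    using le by (intro sum_mono) auto
  also have "\<dots> = K powr t * (\<Sum>x\<in>?e ` (words I k \<times> I (Suc k)). wscale (Suc k) x powr t)"
    unfolding sum.reindex[OF inj] sum_distrib_left by simp
  also have "\<dots> \<le> K powr t * Z (Suc k) t"
    unfolding Z_eq using upd_words finite_words by (intro mult_left_mono sum_mono2) auto
  finally show ?thesis .
qed

text \<open>At the first position \<open>i\<close> where the words differ, the open set condition
  separates the two letters, and the common prefix before \<open>i\<close> is injective. The lengths
  may differ, as is needed for words cut at different levels.\<close>

lemma images_disjoint:
  assumes w: "valid n w" and w': "valid n' w'" and j: "1 \<le> j" "j \<le> n" "j \<le> n'" "w j \<noteq> w' j"
  shows "comp_seg \<phi> w 1 n ` interior X \<inter> comp_seg \<phi> w' 1 n' ` interior X = {}"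
proof -
  let ?P = "\<lambda>j. 1 \<le> j \<and> w j \<noteq> w' j"
  define i where "i = (LEAST j. ?P j)"
  have "?P j" using j by blast
  then have "?P i" "i \<le> j" unfolding i_def by (rule LeastI, rule Least_le)
  then have i: "1 \<le> i" "w i \<noteq> w' i" "i \<le> j" by blast+
  have least: "w l = w' l" if "1 \<le> l" "l < i" for l
    using not_less_Least[of l ?P] that unfolding i_def by blast
  obtain l where l: "i = Suc l" using i by (cases i) auto
  let ?g = "comp_seg \<phi> w 1 l"
  have split: "comp_seg \<phi> u 1 m ` interior X \<subseteq> comp_seg \<phi> u 1 l ` \<phi> i (u i) ` interior X" if "valid m u" "i \<le> m" for m u
  proof -
    have "comp_seg \<phi> u 1 m = comp_seg \<phi> u 1 i \<circ> comp_seg \<phi> u (1 + i) (m - i)"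
      using comp_seg_add[of \<phi> u 1 i "m - i"] that by simp
    moreover have "tame (comp_seg \<phi> u (1 + i) (m - i))" using that by (intro tame_seg) (auto simp: valid_def)
    then have "comp_seg \<phi> u (1 + i) (m - i) ` interior X \<subseteq> interior X" by (rule tame_interior)
    ultimately have "comp_seg \<phi> u 1 m ` interior X \<subseteq> comp_seg \<phi> u 1 i ` interior X" by (metis image_comp image_mono)
    then show ?thesis by (simp add: l image_comp)
  qed
  have g': "comp_seg \<phi> w' 1 l = ?g" using least by (intro comp_seg_cong) (auto simp: l)
  have int: "interior X \<subseteq> V" using interior_subset XV by blast
  have letters: "w i \<in> I i" "w' i \<in> I i" using w w' i j by (auto simp: valid_def)
  have V: "\<phi> i a ` interior X \<subseteq> V" if "a \<in> I i" for a
    using tame_letter[OF i(1) that] int unfolding bd_conformal_def by blast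
  have "inj_on ?g V" using tame_comp[OF valid_mono[OF w, of l]] i j l by (auto simp: bd_conformal_def)
  then have "?g ` \<phi> i (w i) ` interior X \<inter> ?g ` \<phi> i (w' i) ` interior X
      = ?g ` (\<phi> i (w i) ` interior X \<inter> \<phi> i (w' i) ` interior X)"
    using V letters by (intro inj_on_image_Int[symmetric]) auto
  also have "\<dots> = {}" using osc[OF i(1) letters i(2)] by simp
  finally have "?g ` \<phi> i (w i) ` interior X \<inter> ?g ` \<phi> i (w' i) ` interior X = {}" .
  moreover have "i \<le> n" "i \<le> n'" using i j by auto
  ultimately show ?thesis
    using Int_mono[OF split[OF w] split[OF w', unfolded g']] by simp
qed

lemma image_prefix:
  assumes "valid n u" "m \<le> n"
  shows "comp_seg \<phi> u 1 n ` X \<subseteq> comp_seg \<phi> u 1 m ` X"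
proof -
  have "comp_seg \<phi> u 1 n = comp_seg \<phi> u 1 m \<circ> comp_seg \<phi> u (1 + m) (n - m)"
    using comp_seg_add[of \<phi> u 1 m "n - m"] assms by simp
  moreover have "tame (comp_seg \<phi> u (1 + m) (n - m))" using assms by (intro tame_seg) (auto simp: valid_def)
  then have "comp_seg \<phi> u (1 + m) (n - m) ` X \<subseteq> X" by (simp add: bd_conformal_def)
  ultimately show ?thesis by (metis image_comp image_mono)
qed

end

section \<open>Stopping at scale \<open>r\<close>\<close>

lemma sum_UN_le:
  fixes f :: "'b \<Rightarrow> real"
  assumes "finite T" "\<And>i. i \<in> T \<Longrightarrow> finite (A i)" "\<And>x. f x \<ge> 0"
  shows "sum f (\<Union>i\<in>T. A i) \<le> (\<Sum>i\<in>T. sum f (A i))"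
  using assms(1,2)
proof (induction T rule: finite_induct)
  case (insert i T)
  have "sum f (A i \<union> (\<Union>i\<in>T. A i)) \<le> sum f (A i) + sum f (\<Union>i\<in>T. A i)"
    using insert.hyps insert.prems sum_nonneg[of "A i \<inter> (\<Union>i\<in>T. A i)" f] assms(3)
    by (subst sum_Un) (simp_all)
  then show ?case using insert by auto
qed simp

text \<open>Jensen's inequality with equal weights for the exponent \<open>d / t \<ge> 1\<close>,
  applied to the numbers \<open>x a powr t\<close>.\<close>

lemma sum_powr_le_power_mean:
  fixes x :: "'b \<Rightarrow> real" and d :: nat
  assumes "finite S" and x: "\<And>a. a \<in> S \<Longrightarrow> x a > 0" and t: "0 < t" "t \<le> real d"
  shows "(\<Sum>a\<in>S. x a powr t) \<le> real (card S) powr (1 - t / d) * (\<Sum>a\<in>S. x a ^ d) powr (t / d)"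
proof (cases "S = {}")
  case False
  define n where "n = real (card S)"
  have n: "n > 0" using False \<open>finite S\<close> by (simp add: n_def card_gt_0_iff)
  have d: "real d > 0" using t by linarith
  define y where "y = (\<lambda>a. x a powr t)"
  have y: "y a > 0" if "a \<in> S" for a using x[OF that] by (simp add: y_def)
  have sy: "sum y S > 0" using y False \<open>finite S\<close> by (simp add: sum_pos)
  have "(\<Sum>a\<in>S. (1 / n) *\<^sub>R y a) powr (d / t) \<le> (\<Sum>a\<in>S. (1 / n) * (y a powr (d / t)))"
    by (rule convex_on_sum[OF \<open>finite S\<close> False powr_convex[of "d / t"]])
      (use t n y in \<open>auto simp: n_def\<close>)
  moreover have "y a powr (d / t) = x a ^ d" if "a \<in> S" for a
    using x[OF that] t by (simp add: y_def powr_powr powr_realpow)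
  ultimately have "((1 / n) * sum y S) powr (d / t) \<le> (1 / n) * (\<Sum>a\<in>S. x a ^ d)"
    by (simp flip: sum_distrib_left sum_divide_distrib)
  then have "(((1 / n) * sum y S) powr (d / t)) powr (t / d) \<le> ((1 / n) * (\<Sum>a\<in>S. x a ^ d)) powr (t / d)"
    using t by (intro powr_mono2) auto
  then have "(1 / n) * sum y S \<le> (1 / n) powr (t / d) * (\<Sum>a\<in>S. x a ^ d) powr (t / d)"
    using n sy t d by (simp only: powr_powr powr_mult) simp
  then have "sum y S \<le> n * (1 / n) powr (t / d) * (\<Sum>a\<in>S. x a ^ d) powr (t / d)"
    using n by (simp add: field_simps)
  also have "n * (1 / n) powr (t / d) = n powr (1 - t / d)"
    using n by (simp add: powr_diff powr_divide)
  finally show ?thesis by (simp add: y_def n_def)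
qed simp

context finite_ncifs
begin

abbreviation "cylinder n m w \<equiv> {u \<in> words I n. restrict u {1..m} = w}"

abbreviation "hits x r n w \<equiv> comp_seg \<phi> w 1 n ` X \<inter> ball x r \<noteq> {}"

lemma words_differ:
  assumes "v \<in> words I k" "v' \<in> words I k" "v \<noteq> v'"
  shows "\<exists>j. 1 \<le> j \<and> j \<le> k \<and> v j \<noteq> v' j"
proof (rule ccontr)
  assume "\<not> ?thesis"
  then have "v = v'" using assms(1,2) unfolding words_def by (intro PiE_ext) auto
  then show False using assms by simp
qed

section \<open>The mass of the small children of one word\<close>

text \<open>Packing bounds the sum of \<open>d\<close>-th powers of the scales, and the power mean
  turns it into a sum of \<open>t\<close>-th powers, with a factor \<open>?N powr (1 - ?p)\<close>.
  \<open>cylinder_sum_le\<close> converts scales into mass and \<open>Z_Suc_ge\<close> brings in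
  \<open>?N * c powr t\<close>, each at the cost of \<open>K powr t\<close>. The powers of
  \<open>?N\<close> combine to the \<open>t / d\<close> of the theorem.\<close>

lemma children_mass_le:
  fixes x :: 'a
  assumes t: "0 < t" "t \<le> real DIM('a)" and "Suc k \<le> n" and v: "v \<in> words I k" and r: "r > 0"
    and c: "\<And>a. a \<in> I (Suc k) \<Longrightarrow> c \<le> letter (Suc k) a" "c > 0"
  defines "Ch \<equiv> {a \<in> I (Suc k). wscale (Suc k) (v(Suc k := a)) \<le> r \<and> hits x r (Suc k) (v(Suc k := a))}"
  shows "(\<Sum>a\<in>Ch. \<Sum>u\<in>cylinder n (Suc k) (v(Suc k := a)). wscale n u powr t)
           * (Z k t * real (card (I (Suc k))) powr (t / DIM('a)) * c powr t)
         \<le> K powr t * K powr t * packC powr (t / DIM('a)) * r powr t * Z n t"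
proof -
  let ?N = "real (card (I (Suc k)))" and ?p = "t / DIM('a)"
  define s where "s = (\<lambda>a. wscale (Suc k) (v(Suc k := a)))"
  define m where "m = (\<lambda>a. \<Sum>u\<in>cylinder n (Suc k) (v(Suc k := a)). wscale n u powr t)"
  have finI: "finite (I (Suc k))" "I (Suc k) \<noteq> {}" using I_finite I_nonempty by auto
  then have N: "?N > 0" by (simp add: card_gt_0_iff)
  have Ch: "Ch \<subseteq> I (Suc k)" "finite Ch" using finI by (auto simp: Ch_def intro: rev_finite_subset)
  have wd: "v(Suc k := a) \<in> words I (Suc k)" if "a \<in> Ch" for a using that Ch v upd_words by blast
  have spos: "s a > 0" if "a \<in> Ch" for a unfolding s_def by (intro wscale_pos valid_words wd that)
  have "(\<Sum>a\<in>Ch. min (normD (comp_seg \<phi> (v(Suc k := a)) 1 (Suc k)) X) r ^ DIM('a)) \<le> packC * r ^ DIM('a)"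
  proof (rule packing[OF Ch(2) _ r])
    show "tame (comp_seg \<phi> (v(Suc k := a)) 1 (Suc k))" if "a \<in> Ch" for a
      using tame_comp valid_words wd that by blast
    show "hits x r (Suc k) (v(Suc k := a))" if "a \<in> Ch" for a using that by (simp add: Ch_def)
    show "comp_seg \<phi> (v(Suc k := a)) 1 (Suc k) ` interior X \<inter> comp_seg \<phi> (v(Suc k := b)) 1 (Suc k) ` interior X = {}"
      if "a \<in> Ch" "b \<in> Ch" "a \<noteq> b" for a b
      by (rule images_disjoint[where j="Suc k"]) (use that wd valid_words in auto)
  qed
  \<comment> \<open>Children in \<open>Ch\<close> have scale at most \<open>r\<close>, so nothing is
    truncated.\<close>
  moreover have "min (normD (comp_seg \<phi> (v(Suc k := a)) 1 (Suc k)) X) r = s a" if "a \<in> Ch" for a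
    using that by (simp add: Ch_def s_def wscale_def)
  ultimately have pack: "(\<Sum>a\<in>Ch. s a ^ DIM('a)) \<le> packC * r ^ DIM('a)" by simp
  have "(\<Sum>a\<in>Ch. s a powr t) \<le> real (card Ch) powr (1 - ?p) * (\<Sum>a\<in>Ch. s a ^ DIM('a)) powr ?p"
    using Ch(2) spos t by (rule sum_powr_le_power_mean)
  also have "\<dots> \<le> ?N powr (1 - ?p) * (packC * r ^ DIM('a)) powr ?p"
  proof (intro mult_mono powr_mono2)
    show "real (card Ch) \<le> ?N" using card_mono[OF finI(1) Ch(1)] by simp
    show "0 \<le> 1 - ?p" using t by simp
    show "0 \<le> (\<Sum>a\<in>Ch. s a ^ DIM('a))" using spos by (intro sum_nonneg) (simp add: less_imp_le)
  qed (use pack t in auto)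
  also have "(packC * r ^ DIM('a)) powr ?p = packC powr ?p * r powr t"
    using packC_pos r by (simp add: powr_mult powr_powr flip: powr_realpow)
  finally have S: "(\<Sum>a\<in>Ch. s a powr t) \<le> ?N powr (1 - ?p) * (packC powr ?p * r powr t)" .
  have "sum m Ch * Z (Suc k) t = (\<Sum>a\<in>Ch. m a * Z (Suc k) t)" by (simp add: sum_distrib_right)
  also have "\<dots> \<le> (\<Sum>a\<in>Ch. K powr t * s a powr t * Z n t)"
    unfolding m_def s_def using wd t \<open>Suc k \<le> n\<close> by (intro sum_mono cylinder_sum_le) auto
  also have "\<dots> = K powr t * Z n t * (\<Sum>a\<in>Ch. s a powr t)" by (simp add: sum_distrib_left mult_ac)
  also have "\<dots> \<le> K powr t * Z n t * (?N powr (1 - ?p) * (packC powr ?p * r powr t))"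
    using S Z_pos[of n t] by (intro mult_left_mono) auto
  finally have up: "sum m Ch * Z (Suc k) t \<le> K powr t * Z n t * (?N powr (1 - ?p) * (packC powr ?p * r powr t))" .
  have m0: "sum m Ch \<ge> 0" unfolding m_def by (intro sum_nonneg) auto
  have "sum m Ch * (Z k t * ?N * c powr t) \<le> sum m Ch * (K powr t * Z (Suc k) t)"
    using Z_Suc_ge[of t k c] c t m0 by (intro mult_left_mono) auto
  also have "\<dots> = K powr t * (sum m Ch * Z (Suc k) t)" by simp
  also have "\<dots> \<le> K powr t * (K powr t * Z n t * (?N powr (1 - ?p) * (packC powr ?p * r powr t)))"
    using up by (intro mult_left_mono) auto
  finally have le: "sum m Ch * (Z k t * ?N * c powr t)
     \<le> K powr t * (K powr t * Z n t * (?N powr (1 - ?p) * (packC powr ?p * r powr t)))" .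
  \<comment> \<open>The second factor cancels against the one from the power mean.\<close>
  have Ne: "?N = ?N powr ?p * ?N powr (1 - ?p)" using N by (simp flip: powr_add)
  have "?N powr (1 - ?p) * (sum m Ch * (Z k t * ?N powr ?p * c powr t)) = sum m Ch * (Z k t * ?N * c powr t)"
    by (subst (3) Ne) (simp add: mult_ac)
  also note le
  also have "K powr t * (K powr t * Z n t * (?N powr (1 - ?p) * (packC powr ?p * r powr t)))
     = ?N powr (1 - ?p) * (K powr t * K powr t * packC powr ?p * r powr t * Z n t)"
    by (simp add: mult_ac)
  finally show ?thesis using N unfolding m_def by simp
qed

end

section \<open>Chains of parents and their weighted count\<close>

text \<open>\<open>M j\<close> stands for the running maximum of the letter ratios up to level
  \<open>j\<close>.\<close>

locale finite_ncifs_ratio = finite_ncifs X V K \<kappa> R I \<phi> \<eta>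
  for X V :: "'a::euclidean_space set" and K \<kappa> R :: real
    and I :: "nat \<Rightarrow> 'i set" and \<phi> :: "nat \<Rightarrow> 'i \<Rightarrow> 'a \<Rightarrow> 'a" and \<eta> :: real +
  fixes M :: "nat \<Rightarrow> real"
  assumes ratio: "j \<ge> 1 \<Longrightarrow> a \<in> I j \<Longrightarrow> b \<in> I j \<Longrightarrow> normD (\<phi> j a) X \<le> M j * normD (\<phi> j b) X"
    and M_mono: "1 \<le> i \<Longrightarrow> i \<le> j \<Longrightarrow> M i \<le> M j" and M1: "j \<ge> 1 \<Longrightarrow> M j \<ge> 1"
begin

text \<open>Makes \<open>2 + (ln K + l) / ln (1 / \<eta>) \<le> chainC * (1 + l)\<close> for all
  \<open>l \<ge> 0\<close>; the 2 counts the two lowest levels of a chain.\<close>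

definition "chainC = 2 + (ln K + 1) / ln (1 / \<eta>)"

definition has_small_child :: "real \<Rightarrow> nat \<Rightarrow> (nat \<Rightarrow> 'i) \<Rightarrow> bool" where
  "has_small_child r k v \<longleftrightarrow> (\<exists>a\<in>I (Suc k). wscale (Suc k) (v(Suc k := a)) \<le> r)"

text \<open>One child at level \<open>k1 + 1\<close> has scale at most \<open>r\<close>, so the
  ratio bound limits its sibling along \<open>v\<close> to \<open>K * M (Suc k1) * r\<close>. From
  there each level shrinks by \<open>\<eta>\<close>, yet level \<open>k\<close> is still above
  \<open>r\<close>.\<close>

lemma chain_length:
  assumes v: "valid k v" and "k1 < k" and big: "wscale k v > r" and small: "has_small_child r k1 v" and "r > 0"
  shows "real k \<le> real k1 + 1 + ln (K * M (Suc k1)) / ln (1 / \<eta>)"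
proof -
  obtain a where a: "a \<in> I (Suc k1)" "wscale (Suc k1) (v(Suc k1 := a)) \<le> r"
    using small by (auto simp: has_small_child_def)
  have v1: "valid (Suc k1) v" "valid k1 v" using valid_mono[OF v] \<open>k1 < k\<close> by auto
  have va: "valid (Suc k1) (v(Suc k1 := a))" using v1 a by (auto simp: valid_def)
  have eq: "wscale k1 (v(Suc k1 := a)) = wscale k1 v" by (intro wscale_cong) auto
  have M: "M (Suc k1) \<ge> 1" using M1 by simp
  have "wscale (Suc k1) v \<le> wscale k1 v * letter (Suc k1) (v (Suc k1))" by (rule wscale_Suc_le[OF v1(1)])
  also have "\<dots> \<le> wscale k1 v * (M (Suc k1) * letter (Suc k1) a)"
    using wscale_pos[OF v1(2)] v1 a by (intro mult_left_mono ratio) (auto simp: valid_def)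
  also have "\<dots> = M (Suc k1) * (wscale k1 v * letter (Suc k1) a)" by simp
  also have "\<dots> \<le> M (Suc k1) * (K * wscale (Suc k1) (v(Suc k1 := a)))"
    using wscale_Suc_ge[OF va] M eq by (intro mult_left_mono) auto
  also have "\<dots> \<le> M (Suc k1) * (K * r)" using a M K1 by (intro mult_left_mono) auto
  finally have le1: "wscale (Suc k1) v \<le> K * M (Suc k1) * r" by (simp add: mult_ac)
  define e where "e = k - Suc k1"
  have "r < wscale k v" by (rule big)
  also have "wscale k v \<le> \<eta> ^ e * wscale (Suc k1) v"
    using wscale_add_le[of "Suc k1" e v] v \<open>k1 < k\<close> by (simp add: e_def)
  also have "\<dots> \<le> \<eta> ^ e * (K * M (Suc k1) * r)" using le1 \<eta>_pos by (intro mult_left_mono) auto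
  finally have "1 < \<eta> ^ e * (K * M (Suc k1))" using \<open>r > 0\<close> by (simp add: mult.assoc[symmetric])
  then have "(1 / \<eta>) ^ e < K * M (Suc k1)" using \<eta>_pos by (simp add: field_simps)
  then have "ln ((1 / \<eta>) ^ e) \<le> ln (K * M (Suc k1))" using \<eta>_pos K1 M by (intro ln_mono) auto
  then have "real e * ln (1 / \<eta>) \<le> ln (K * M (Suc k1))" using \<eta>_pos by (simp add: ln_realpow)
  moreover have "ln (1 / \<eta>) > 0" using \<eta>_pos \<eta>1 by (intro ln_gt_zero) auto
  ultimately have "real e \<le> ln (K * M (Suc k1)) / ln (1 / \<eta>)" by (simp add: field_simps)
  then show ?thesis using \<open>k1 < k\<close> by (simp add: e_def of_nat_diff)
qed

text \<open>With \<open>k1\<close> the lowest level and \<open>l = ln (M (Suc k1))\<close>, there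
  are at most \<open>chainC * (1 + l)\<close> levels, and by monotonicity of \<open>M\<close> each
  contributes at most \<open>1 / (1 + l)\<close>.\<close>

lemma chain_sum_le:
  assumes "finite L" and "r > 0"
    and L: "\<And>k. k \<in> L \<Longrightarrow> valid k v \<and> wscale k v > r \<and> has_small_child r k v"
  shows "(\<Sum>k\<in>L. 1 / (1 + ln (M (Suc k)))) \<le> chainC"
proof -
  have le: "ln (1 / \<eta>) > 0" using \<eta>_pos \<eta>1 by (intro ln_gt_zero) auto
  have lnK: "ln K \<ge> 0" using K1 by simp
  have C0: "chainC \<ge> 0" unfolding chainC_def using le lnK by (simp add: add_nonneg_nonneg)
  show ?thesis
  proof (cases "L = {}")
    case True
    then show ?thesis using C0 by simp
  next
    case False
    define k1 where "k1 = Min L"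
    have k1: "k1 \<in> L" "\<And>k. k \<in> L \<Longrightarrow> k1 \<le> k" using False \<open>finite L\<close> by (auto simp: k1_def)
    define l where "l = ln (M (Suc k1))"
    have l: "l \<ge> 0" using M1[of "Suc k1"] by (simp add: l_def)
    define D where "D = (ln K + l) / ln (1 / \<eta>)"
    have D: "D \<ge> 0" using l lnK le by (simp add: D_def)
    have "ln (K * M (Suc k1)) = ln K + l" using K1 M1[of "Suc k1"] by (simp add: l_def ln_mult)
    then have "real k \<le> real k1 + 1 + D" if "k \<in> L" for k
      using chain_length[of k v k1 r] L[OF that] L[OF k1(1)] k1(2)[OF that] \<open>r > 0\<close> D
      by (cases "k1 = k") (auto simp: D_def)
    then have "k \<le> k1 + 1 + nat \<lfloor>D\<rfloor>" if "k \<in> L" for k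
    proof -
      have "real (k - (k1 + 1)) \<le> D" using that D \<open>\<And>k. k \<in> L \<Longrightarrow> real k \<le> real k1 + 1 + D\<close>[of k] by (simp add: of_nat_diff_real)
      then have "k - (k1 + 1) \<le> nat \<lfloor>D\<rfloor>" by (rule le_nat_floor)
      then show ?thesis by simp
    qed
    then have "L \<subseteq> {k1..k1 + 1 + nat \<lfloor>D\<rfloor>}" using k1 by auto
    then have "card L \<le> card {k1..k1 + 1 + nat \<lfloor>D\<rfloor>}" by (intro card_mono) auto
    then have "real (card L) \<le> 2 + real (nat \<lfloor>D\<rfloor>)" by simp
    also have "\<dots> \<le> 2 + D" using D by (simp add: of_nat_floor)
    also have "\<dots> \<le> chainC * (1 + l)"
    proof -
      have "ln K + l \<le> (ln K + 1) * (1 + l)" using l lnK by (simp add: algebra_simps)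
      then have "D \<le> (ln K + 1) / ln (1 / \<eta>) * (1 + l)" using le by (simp add: D_def divide_right_mono)
      moreover have "2 \<le> 2 * (1 + l)" using l by simp
      ultimately show ?thesis unfolding chainC_def by (simp only: distrib_right)
    qed
    finally have card: "real (card L) \<le> chainC * (1 + l)" .
    have "(\<Sum>k\<in>L. 1 / (1 + ln (M (Suc k)))) \<le> (\<Sum>k\<in>L. 1 / (1 + l))"
    proof (intro sum_mono divide_left_mono)
      fix k assume k: "k \<in> L"
      have "M (Suc k1) \<le> M (Suc k)" using k1(2)[OF k] by (intro M_mono) auto
      then have "l \<le> ln (M (Suc k))" using M1[of "Suc k1"] by (simp add: l_def)
      then show "1 + l \<le> 1 + ln (M (Suc k))" "0 < (1 + ln (M (Suc k))) * (1 + l)" using l by auto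
    qed auto
    also have "\<dots> = real (card L) / (1 + l)" by simp
    also have "\<dots> \<le> chainC" using card l by (simp add: divide_le_eq)
    finally show ?thesis .
  qed
qed

text \<open>Order the parents by the prefix relation. Maximal ones are incomparable, so their images
  are disjoint and, having scale above \<open>r\<close>, at most \<open>packC\<close> in number.
  Every parent is a prefix of a maximal one, and the prefixes of one word form a chain.\<close>

lemma parents_sum_le:
  assumes "finite P" and "r > 0"
    and P: "\<And>k v. (k, v) \<in> P \<Longrightarrow> v \<in> words I k \<and> wscale k v > r \<and> hits x r k v \<and> has_small_child r k v"
  shows "(\<Sum>(k, v)\<in>P. 1 / (1 + ln (M (Suc k)))) \<le> packC * chainC"
proof -
  define Q where "Q = {(k, v)\<in>P. \<forall>(k', v')\<in>P. k < k' \<longrightarrow> restrict v' {1..k} \<noteq> v}"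
  have "finite Q" using \<open>finite P\<close> by (auto simp: Q_def intro: rev_finite_subset)
  have QP: "Q \<subseteq> P" by (auto simp: Q_def)
  have disj: "comp_seg \<phi> v 1 k ` interior X \<inter> comp_seg \<phi> v' 1 k' ` interior X = {}"
    if q: "(k, v) \<in> Q" "(k', v') \<in> Q" "(k, v) \<noteq> (k', v')" "k \<le> k'" for k v k' v'
  proof -
    have w: "v \<in> words I k" "v' \<in> words I k'" using P q QP by blast+
    have "restrict v' {1..k} \<in> words I k" using restrict_words w q by blast
    moreover have "restrict v' {1..k} \<noteq> v"
    proof (cases "k = k'")
      case True
      then have "restrict v' {1..k} = v'" using w by (auto simp: words_def)
      then show ?thesis using q True by auto
    next
      case False
      then have "k < k'" using q by simp
      then show ?thesis using q QP unfolding Q_def by blast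
    qed
    ultimately obtain j where "1 \<le> j" "j \<le> k" "v j \<noteq> v' j"
      using words_differ[OF w(1), of "restrict v' {1..k}"] by force
    then show ?thesis
      using images_disjoint[of k v k' v' j] valid_words[OF w(1)] valid_words[OF w(2)] q by auto
  qed
  have "(\<Sum>q\<in>Q. min (normD (comp_seg \<phi> (snd q) 1 (fst q)) X) r ^ DIM('a)) \<le> packC * r ^ DIM('a)"
  proof (rule packing[OF \<open>finite Q\<close> _ \<open>r > 0\<close>])
    show "tame (comp_seg \<phi> (snd q) 1 (fst q))" if "q \<in> Q" for q
      using tame_comp valid_words P[of "fst q" "snd q"] QP that by auto
    show "hits x r (fst q) (snd q)" if "q \<in> Q" for q using P[of "fst q" "snd q"] QP that by auto
    show "comp_seg \<phi> (snd p) 1 (fst p) ` interior X \<inter> comp_seg \<phi> (snd q) 1 (fst q) ` interior X = {}"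
      if "p \<in> Q" "q \<in> Q" "p \<noteq> q" for p q
    proof (cases "fst p \<le> fst q")
      case True
      then show ?thesis using disj[of "fst p" "snd p" "fst q" "snd q"] that by simp
    next
      case False
      then show ?thesis using disj[of "fst q" "snd q" "fst p" "snd p"] that by (simp add: Int_commute)
    qed
  qed
  \<comment> \<open>Scales above \<open>r\<close> are truncated to exactly \<open>r\<close>, so
    packing counts \<open>Q\<close>.\<close>
  moreover have "min (normD (comp_seg \<phi> (snd q) 1 (fst q)) X) r = r" if "q \<in> Q" for q
    using P[of "fst q" "snd q"] QP that by (auto simp: wscale_def)
  ultimately have cardQ: "real (card Q) \<le> packC" using \<open>r > 0\<close> by simp
  define chain where "chain = (\<lambda>q :: nat \<times> (nat \<Rightarrow> 'i). {k. k \<le> fst q \<and> (k, restrict (snd q) {1..k}) \<in> P})"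
  define node where "node = (\<lambda>q :: nat \<times> (nat \<Rightarrow> 'i). \<lambda>k. (k, restrict (snd q) {1..k}))"
  have fch: "finite (chain q)" for q unfolding chain_def by (rule finite_subset[of _ "{..fst q}"]) auto
  have "P \<subseteq> (\<Union>q\<in>Q. node q ` chain q)"
  proof clarify
    fix k v assume kv: "(k, v) \<in> P"
    \<comment> \<open>A longest extension of \<open>v\<close> among the parents is maximal: a
      further extension would again extend \<open>v\<close>.\<close>
    define E where "E = {(k', v')\<in>P. k \<le> k' \<and> restrict v' {1..k} = v}"
    have "finite E" using \<open>finite P\<close> by (auto simp: E_def intro: rev_finite_subset)
    have rv: "restrict v {1..k} = v" using P[OF kv] by (auto simp: words_def)
    then have "(k, v) \<in> E" using kv by (simp add: E_def)
    define k' where "k' = Max (fst ` E)"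
    have "k' \<in> fst ` E" unfolding k'_def using \<open>finite E\<close> \<open>(k, v) \<in> E\<close> by (intro Max_in) auto
    then obtain v' where v': "(k', v') \<in> E" by auto
    have "(k', v') \<in> Q"
    proof -
      have False if "(k'', v'') \<in> P" "k' < k''" "restrict v'' {1..k'} = v'" for k'' v''
      proof -
        have kk: "k \<le> k'" "restrict v' {1..k} = v" using v' by (auto simp: E_def)
        have "restrict v'' {1..k} = restrict (restrict v'' {1..k'}) {1..k}" using kk by (auto simp: restrict_def)
        then have "restrict v'' {1..k} = v" by (simp only: that(3) kk(2))
        then have "(k'', v'') \<in> E" using that kk by (simp add: E_def)
        then have "k'' \<le> k'" unfolding k'_def using \<open>finite E\<close> by (intro Max_ge) force+
        then show False using that by simp
      qed
      then show ?thesis using v' by (auto simp: Q_def E_def)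
    qed
    moreover have "k \<in> chain (k', v')" "(k, v) = node (k', v') k" using v' kv by (auto simp: chain_def node_def E_def)
    ultimately show "(k, v) \<in> (\<Union>q\<in>Q. node q ` chain q)" by blast
  qed
  moreover have pos: "0 \<le> 1 / (1 + ln (M (Suc k)))" for k using M1[of "Suc k"] by simp
  ultimately have "(\<Sum>(k, v)\<in>P. 1 / (1 + ln (M (Suc k)))) \<le> (\<Sum>(k, v)\<in>(\<Union>q\<in>Q. node q ` chain q). 1 / (1 + ln (M (Suc k))))"
    using \<open>finite Q\<close> fch by (intro sum_mono2) auto
  also have "\<dots> \<le> (\<Sum>q\<in>Q. \<Sum>(k, v)\<in>node q ` chain q. 1 / (1 + ln (M (Suc k))))"
    using \<open>finite Q\<close> fch pos by (intro sum_UN_le) auto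
  also have "\<dots> = (\<Sum>q\<in>Q. \<Sum>k\<in>chain q. 1 / (1 + ln (M (Suc k))))"
    by (intro sum.cong refl, subst sum.reindex) (auto simp: inj_on_def node_def)
  also have "\<dots> \<le> (\<Sum>q\<in>Q. chainC)"
  proof (rule sum_mono, rule chain_sum_le[OF fch \<open>r > 0\<close>])
    \<comment> \<open>\<open>chain_sum_le\<close> is applied to the single word
      \<open>snd q\<close>; restricting it does not change the scales of its prefixes or of their
      children.\<close>
    fix q k assume q: "q \<in> Q" and k: "k \<in> chain q"
    let ?v = "snd q" and ?w = "restrict (snd q) {1..k}"
    have "(k, ?w) \<in> P" and kq: "k \<le> fst q" using k by (auto simp: chain_def)
    then have w: "wscale k ?w > r" "has_small_child r k ?w" using P by blast+
    have "q \<in> P" using q QP by blast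
    then have "valid (fst q) ?v" using valid_words P[of "fst q" ?v] by auto
    then have "valid k ?v" using kq by (rule valid_mono)
    moreover have "wscale k ?w = wscale k ?v" by (intro wscale_cong) auto
    moreover have "wscale (Suc k) (?w(Suc k := a)) = wscale (Suc k) (?v(Suc k := a))" for a
      by (intro wscale_cong) auto
    ultimately show "valid k ?v \<and> wscale k ?v > r \<and> has_small_child r k ?v"
      using w by (simp add: has_small_child_def)
  qed
  also have "\<dots> = real (card Q) * chainC" by simp
  also have "\<dots> \<le> packC * chainC"
  proof (rule mult_right_mono[OF cardQ])
    have "ln (1 / \<eta>) > 0" using \<eta>_pos \<eta>1 by (intro ln_gt_zero) auto
    then show "0 \<le> chainC" unfolding chainC_def using K1 by (simp add: add_nonneg_nonneg)
  qed
  finally show ?thesis .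
qed

end

section \<open>The Frostman estimate and Hausdorff measure\<close>

context finite_ncifs_ratio
begin

text \<open>\<open>small\<close> ensures that every word of length \<open>n\<close> has been cut by
  then, and \<open>big\<close> that no cut happens up to level \<open>n0\<close>, so that
  \<open>low\<close> applies to each parent. Summing \<open>children_mass_le\<close> over the
  parents leaves the weights \<open>1 / (1 + ln (M (Suc k)))\<close> controlled by
  \<open>parents_sum_le\<close>.\<close>

lemma ball_mass_le:
  fixes x :: 'a
  assumes t: "0 < t" "t \<le> real DIM('a)" and "\<delta> > 0"
    and c: "\<And>j a. j \<ge> 1 \<Longrightarrow> a \<in> I j \<Longrightarrow> c j \<le> letter j a" "\<And>j. j \<ge> 1 \<Longrightarrow> c j > 0"
    and low: "\<And>k. k \<ge> n0 \<Longrightarrow> \<delta> * (1 + ln (M (Suc k))) \<le> Z k t * real (card (I (Suc k))) powr (t / DIM('a)) * c (Suc k) powr t"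
    and r: "r > 0" and big: "\<And>m w. m \<le> n0 \<Longrightarrow> w \<in> words I m \<Longrightarrow> r < wscale m w"
    and small: "\<And>u. u \<in> words I n \<Longrightarrow> wscale n u \<le> r"
  shows "(\<Sum>u\<in>{u \<in> words I n. hits x r n u}. wscale n u powr t)
     \<le> (K powr t * K powr t * packC powr (t / DIM('a)) / \<delta> * (packC * chainC)) * r powr t * Z n t"
proof -
  define P where "P = {(k, v). k < n \<and> v \<in> words I k \<and> wscale k v > r \<and> hits x r k v \<and> has_small_child r k v}"
  define Ch where "Ch = (\<lambda>k v. {a \<in> I (Suc k). wscale (Suc k) (v(Suc k := a)) \<le> r \<and> hits x r (Suc k) (v(Suc k := a))})"
  define B where "B = K powr t * K powr t * packC powr (t / DIM('a)) * r powr t * Z n t"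
  have B0: "B \<ge> 0" unfolding B_def using Z_pos[of n t] by (auto intro!: mult_nonneg_nonneg)
  have "P \<subseteq> Sigma {..<n} (words I)" by (auto simp: P_def)
  then have "finite P" by (rule finite_subset) (auto intro: finite_words)
  have fCh: "finite (Ch k v)" for k v using I_finite[of "Suc k"] by (auto simp: Ch_def)
  have fcyl: "finite (cylinder n m w)" for m w using finite_words by auto
  have "{u \<in> words I n. hits x r n u} \<subseteq> (\<Union>(k, v)\<in>P. \<Union>a\<in>Ch k v. cylinder n (Suc k) (v(Suc k := a)))"
  proof
    fix u assume "u \<in> {u \<in> words I n. hits x r n u}"
    then have u: "u \<in> words I n" "hits x r n u" by auto
    \<comment> \<open>The cut level of \<open>u\<close>. It is not 0, since the empty word has scale
      1 and \<open>big\<close> gives \<open>r < 1\<close>.\<close>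
    define m where "m = (LEAST m. wscale m u \<le> r)"
    have m: "wscale m u \<le> r" "m \<le> n" unfolding m_def using small[OF u(1)] by (rule LeastI, rule Least_le)
    have "m \<noteq> 0"
    proof
      assume "m = 0"
      obtain w where "w \<in> words I 0" using words_nonempty by blast
      then have "r < 1" using big[of 0 w] by (simp add: wscale_0)
      then show False using m \<open>m = 0\<close> by (simp add: wscale_0)
    qed
    then obtain k where k: "m = Suc k" by (cases m) auto
    have ku: "wscale k u > r" using not_less_Least[of k "\<lambda>m. wscale m u \<le> r"] k by (simp add: m_def)
    let ?v = "restrict u {1..k}" and ?a = "u (Suc k)"
    have va: "?v(Suc k := ?a) = restrict u {1..Suc k}" by (auto simp: fun_eq_iff)
    have hit: "hits x r l (restrict u {1..l})" if "l \<le> n" for l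
    proof -
      have "comp_seg \<phi> (restrict u {1..l}) 1 l = comp_seg \<phi> u 1 l" by (rule comp_seg_cong) auto
      then show ?thesis using image_prefix[OF valid_words[OF u(1)] that] u(2) by auto
    qed
    have sc: "wscale l (restrict u {1..l}) = wscale l u" for l by (rule wscale_cong) auto
    have aI: "?a \<in> I (Suc k)" using valid_words[OF u(1)] m k by (auto simp: valid_def)
    have kn: "k < n" using m k by simp
    have s1: "wscale (Suc k) (?v(Suc k := ?a)) \<le> r" unfolding va sc using m k by simp
    have "has_small_child r k ?v" unfolding has_small_child_def using aI s1 by (rule bexI[rotated])
    then have "(k, ?v) \<in> P"
      unfolding P_def using kn ku restrict_words[OF u(1), of k] hit[of k] sc[of k] by simp
    moreover have "?a \<in> Ch k ?v"
      unfolding Ch_def using aI s1 hit[of "Suc k"] kn va by simp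
    moreover have "u \<in> cylinder n (Suc k) (?v(Suc k := ?a))" unfolding va using u by simp
    ultimately show "u \<in> (\<Union>(k, v)\<in>P. \<Union>a\<in>Ch k v. cylinder n (Suc k) (v(Suc k := a)))" by blast
  qed
  then have "(\<Sum>u\<in>{u \<in> words I n. hits x r n u}. wscale n u powr t)
     \<le> (\<Sum>u\<in>(\<Union>(k, v)\<in>P. \<Union>a\<in>Ch k v. cylinder n (Suc k) (v(Suc k := a))). wscale n u powr t)"
    using \<open>finite P\<close> fCh fcyl by (intro sum_mono2) auto
  also have "\<dots> \<le> (\<Sum>q\<in>P. \<Sum>u\<in>(case q of (k, v) \<Rightarrow> \<Union>a\<in>Ch k v. cylinder n (Suc k) (v(Suc k := a))). wscale n u powr t)"
    using \<open>finite P\<close> fCh fcyl by (intro sum_UN_le) auto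
  also have "\<dots> \<le> (\<Sum>(k, v)\<in>P. B / \<delta> * (1 / (1 + ln (M (Suc k)))))"
  proof (rule sum_mono, clarify)
    fix k v assume kv: "(k, v) \<in> P"
    then have v: "v \<in> words I k" and kn: "Suc k \<le> n" and "has_small_child r k v" by (auto simp: P_def)
    then obtain a where a: "a \<in> I (Suc k)" "wscale (Suc k) (v(Suc k := a)) \<le> r" by (auto simp: has_small_child_def)
    \<comment> \<open>The small child sits at level \<open>k + 1\<close>, which \<open>big\<close>
      forces beyond \<open>n0\<close>.\<close>
    have "k \<ge> n0" using big[of "Suc k", OF _ upd_words[OF v a(1)]] a(2) by (cases "Suc k \<le> n0") auto
    define T where "T = Z k t * real (card (I (Suc k))) powr (t / DIM('a)) * c (Suc k) powr t"
    define W where "W = (\<Sum>a\<in>Ch k v. \<Sum>u\<in>cylinder n (Suc k) (v(Suc k := a)). wscale n u powr t)"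
    have L: "1 + ln (M (Suc k)) > 0" using M1[of "Suc k"] by (simp add: add_pos_nonneg)
    have T: "\<delta> * (1 + ln (M (Suc k))) \<le> T" unfolding T_def by (rule low[OF \<open>k \<ge> n0\<close>])
    have W0: "W \<ge> 0" unfolding W_def by (intro sum_nonneg) auto
    have "W * (\<delta> * (1 + ln (M (Suc k)))) \<le> W * T" using T W0 by (intro mult_left_mono)
    also have "\<dots> \<le> B"
      unfolding W_def T_def B_def Ch_def using t kn v r c by (intro children_mass_le) auto
    finally have WB: "W \<le> B / \<delta> * (1 / (1 + ln (M (Suc k))))"
      using mult_pos_pos[OF \<open>\<delta> > 0\<close> L] by (simp add: pos_le_divide_eq)
    have "(\<Sum>u\<in>(\<Union>a\<in>Ch k v. cylinder n (Suc k) (v(Suc k := a))). wscale n u powr t) \<le> W"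
      unfolding W_def using fCh fcyl by (intro sum_UN_le) auto
    then show "(\<Sum>u\<in>(\<Union>a\<in>Ch k v. cylinder n (Suc k) (v(Suc k := a))). wscale n u powr t) \<le> B / \<delta> * (1 / (1 + ln (M (Suc k))))"
      using WB by linarith
  qed
  also have "\<dots> = B / \<delta> * (\<Sum>(k, v)\<in>P. 1 / (1 + ln (M (Suc k))))"
    unfolding sum_distrib_left by (intro sum.cong) auto
  also have "\<dots> \<le> B / \<delta> * (packC * chainC)"
    using B0 \<open>\<delta> > 0\<close> \<open>finite P\<close> r by (intro mult_left_mono parents_sum_le[where r=r and x=x]) (auto simp: P_def)
  finally show ?thesis unfolding B_def by (simp add: mult_ac)
qed

end

section \<open>From masses on finite levels to Hausdorff measure\<close>

context finite_ncifs
begin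

definition "level n = (\<Union>w\<in>words I n. comp_seg \<phi> w 1 n ` X)"

lemma compact_level: "compact (level n)"
  unfolding level_def
proof (rule compact_UN[OF finite_words])
  fix w assume "w \<in> words I n"
  then have "tame (comp_seg \<phi> w 1 n)" by (intro tame_comp valid_words)
  then show "compact (comp_seg \<phi> w 1 n ` X)"
    using compactX XV by (intro compact_continuous_image continuous_on_subset[OF tame_continuous])
qed

lemma level_decreasing:
  assumes "m \<le> n" shows "level n \<subseteq> level m"
  unfolding level_def
proof (rule UN_least)
  fix w assume w: "w \<in> words I n"
  have "comp_seg \<phi> (restrict w {1..m}) 1 m = comp_seg \<phi> w 1 m" by (rule comp_seg_cong) auto
  then have "comp_seg \<phi> w 1 n ` X \<subseteq> comp_seg \<phi> (restrict w {1..m}) 1 m ` X"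
    using image_prefix[OF valid_words[OF w] assms] by simp
  then show "comp_seg \<phi> w 1 n ` X \<subseteq> (\<Union>w\<in>words I m. comp_seg \<phi> w 1 m ` X)"
    using restrict_words[OF w assms] by blast
qed

text \<open>Otherwise the sets \<open>level n - G\<close> would be nonempty, compact and nested, and
  a common point would lie in the limit set but not in \<open>G\<close>.\<close>

lemma level_subset_open:
  assumes "open G" "limit_set X I \<phi> \<subseteq> G"
  shows "\<exists>n. level n \<subseteq> G"
proof (rule ccontr)
  assume *: "\<not> ?thesis"
  have "\<Inter>(range (\<lambda>n. level n - G)) \<noteq> {}"
  proof (rule compact_nest)
    show "compact (level n - G)" for n using compact_diff[OF compact_level \<open>open G\<close>] .
    show "level n - G \<noteq> {}" for n using * by blast
    show "level n - G \<subseteq> level m - G" if "m \<le> n" for m n using level_decreasing[OF that] by blast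
  qed
  moreover have "limit_set X I \<phi> = (\<Inter>n. level n)" by (simp add: limit_set_def level_def)
  ultimately show False using assms(2) by auto
qed

text \<open>The mass distribution principle with finite levels in place of a measure: finitely many
  balls covering some level are hit by all words of length \<open>n\<close>, so the estimate
  \<open>mass\<close> gives \<open>Z n t \<le> C * (\<Sum>i\<in>F. r i powr t) * Z n t\<close>, and
  \<open>Z n t\<close> cancels.\<close>

lemma hausdorff_measure_limit_set_pos:
  assumes "0 \<le> s" "s \<le> t" "t > 0" "C > 0" "r0 > 0"
    and mass: "\<And>x r n. 0 < r \<Longrightarrow> r < r0 \<Longrightarrow> (\<And>u. u \<in> words I n \<Longrightarrow> wscale n u \<le> r) \<Longrightarrow>
       (\<Sum>u\<in>{u \<in> words I n. hits x r n u}. wscale n u powr t) \<le> C * r powr t * Z n t"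
  shows "hausdorff_measure s (limit_set X I \<phi>) > 0"
proof -
  let ?J = "limit_set X I \<phi>"
  \<comment> \<open>Half of \<open>1 / C\<close>: the other half pays for enlarging the covering
    sets.\<close>
  define \<theta> where "\<theta> = 1 / (2 * C)"
  have "\<theta> > 0" using \<open>C > 0\<close> by (simp add: \<theta>_def)
  \<comment> \<open>\<open>\<delta> \<le> 1\<close> gives
    \<open>D i powr t \<le> D i powr s\<close>; \<open>\<delta> < r0\<close> leaves room for radii
    below \<open>r0\<close>.\<close>
  define \<delta> where "\<delta> = min 1 (r0 / 2)"
  have \<delta>: "\<delta> > 0" "\<delta> \<le> 1" "\<delta> < r0" using \<open>r0 > 0\<close> by (auto simp: \<delta>_def)
  have key: "ennreal \<theta> \<le> (\<Sum>i. (if U i = {} then 0 else if s = 0 then 1 else ennreal (diameter (U i) powr s)))"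
    if U: "?J \<subseteq> (\<Union>i. U i)" "\<And>i. bounded (U i) \<and> diameter (U i) \<le> \<delta>" for U :: "nat \<Rightarrow> 'a set"
  proof -
    define D where "D = (\<lambda>i. diameter (U i))"
    have D: "0 \<le> D i" "D i \<le> \<delta>" for i using U(2)[of i] diameter_ge_0 by (auto simp: D_def)
    \<comment> \<open>The balls are open and a diameter may be 0, so radii must exceed diameters
      strictly. Right continuity of the power, valid at 0 because \<open>t > 0\<close>, keeps the
      total extra cost at most \<open>\<theta>\<close>.\<close>
    have "\<exists>r>D i. r < r0 \<and> r powr t < D i powr t + \<theta> * (1 / 2) ^ Suc i" for i
    proof -
      have "((\<lambda>r. r powr t) \<longlongrightarrow> D i powr t) (at_right (D i))"
      proof (rule tendsto_powr2)
        show "\<forall>\<^sub>F r in at_right (D i). 0 \<le> r"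
          using D(1)[of i] by (auto simp: eventually_at_right_field intro!: exI[of _ "D i + 1"])
      qed (use \<open>t > 0\<close> in \<open>auto intro: tendsto_intros\<close>)
      moreover have "D i powr t < D i powr t + \<theta> * (1 / 2) ^ Suc i" using \<open>\<theta> > 0\<close> by simp
      ultimately have "\<forall>\<^sub>F r in at_right (D i). r powr t < D i powr t + \<theta> * (1 / 2) ^ Suc i"
        by (rule order_tendstoD(2))
      moreover have "\<forall>\<^sub>F r in at_right (D i). r < r0"
        using D(2)[of i] \<delta> by (auto simp: eventually_at_right_field intro!: exI[of _ r0])
      moreover have "\<forall>\<^sub>F r in at_right (D i). r > D i" by (rule eventually_at_right_less)
      ultimately have "\<forall>\<^sub>F r in at_right (D i). r > D i \<and> r < r0 \<and> r powr t < D i powr t + \<theta> * (1 / 2) ^ Suc i"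
        by eventually_elim auto
      then show ?thesis using eventually_happens trivial_limit_at_right_real by blast
    qed
    then obtain r where r: "\<And>i. r i > D i" "\<And>i. r i < r0" "\<And>i. r i powr t < D i powr t + \<theta> * (1 / 2) ^ Suc i"
      by metis
    have r_pos: "r i > 0" for i using r(1)[of i] D(1)[of i] by linarith
    define N where "N = {i. U i \<noteq> {}}"
    have "\<forall>i\<in>N. \<exists>x. x \<in> U i" by (auto simp: N_def)
    then obtain p where p: "\<And>i. i \<in> N \<Longrightarrow> p i \<in> U i" by metis
    have sub: "U i \<subseteq> ball (p i) (r i)" if "i \<in> N" for i
    proof
      fix y assume "y \<in> U i"
      then have "dist (p i) y \<le> D i"
        unfolding D_def using U(2)[of i] p[OF that] by (intro diameter_bounded_bound) auto
      then show "y \<in> ball (p i) (r i)" using r(1)[of i] by simp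
    qed
    have "?J \<subseteq> (\<Union>i\<in>N. ball (p i) (r i))"
    proof
      fix y assume "y \<in> ?J"
      then obtain i where "y \<in> U i" using U(1) by blast
      moreover from this have "i \<in> N" by (auto simp: N_def)
      ultimately show "y \<in> (\<Union>i\<in>N. ball (p i) (r i))" using sub by blast
    qed
    moreover have "open (\<Union>i\<in>N. ball (p i) (r i))" by auto
    ultimately obtain m where m: "level m \<subseteq> (\<Union>i\<in>N. ball (p i) (r i))" using level_subset_open by blast
    obtain F where F: "F \<subseteq> N" "finite F" "level m \<subseteq> (\<Union>i\<in>F. ball (p i) (r i))"
      using compactE_image[OF compact_level _ m] by auto
    define rm where "rm = Min (insert 1 (r ` F))"
    have rm: "rm > 0" "\<And>i. i \<in> F \<Longrightarrow> rm \<le> r i" using F r_pos by (auto simp: rm_def)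
    \<comment> \<open>Deep enough that all scales are below every chosen radius, as
      \<open>mass\<close> requires.\<close>
    obtain l where l: "\<eta> ^ l < rm" using real_arch_pow_inv[OF rm(1) \<eta>1] by blast
    define n where "n = max m l"
    have "\<eta> ^ n \<le> \<eta> ^ l" using \<eta>_pos \<eta>1 by (intro power_decreasing) (auto simp: n_def)
    then have small: "wscale n u \<le> r i" if "u \<in> words I n" "i \<in> F" for u i
      using wscale_le[OF valid_words[OF that(1)]] l rm(2)[OF that(2)] by linarith
    have "words I n \<subseteq> (\<Union>i\<in>F. {u \<in> words I n. hits (p i) (r i) n u})"
    proof
      fix u assume u: "u \<in> words I n"
      obtain y where y: "y \<in> X" using nonempty by blast
      have "comp_seg \<phi> u 1 n y \<in> level n" using u y by (auto simp: level_def)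
      also have "\<dots> \<subseteq> level m" by (rule level_decreasing) (simp add: n_def)
      finally obtain i where "i \<in> F" "comp_seg \<phi> u 1 n y \<in> ball (p i) (r i)" using F by blast
      then show "u \<in> (\<Union>i\<in>F. {u \<in> words I n. hits (p i) (r i) n u})" using u y by blast
    qed
    then have "Z n t \<le> (\<Sum>u\<in>(\<Union>i\<in>F. {u \<in> words I n. hits (p i) (r i) n u}). wscale n u powr t)"
      unfolding Z_eq using F finite_words by (intro sum_mono2) auto
    also have "\<dots> \<le> (\<Sum>i\<in>F. \<Sum>u\<in>{u \<in> words I n. hits (p i) (r i) n u}. wscale n u powr t)"
      using F finite_words by (intro sum_UN_le) auto
    also have "\<dots> \<le> (\<Sum>i\<in>F. C * r i powr t * Z n t)"
      using r r_pos small by (intro sum_mono mass) auto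
    also have "\<dots> = C * (\<Sum>i\<in>F. r i powr t) * Z n t" by (simp add: sum_distrib_left sum_distrib_right)
    finally have "1 \<le> C * (\<Sum>i\<in>F. r i powr t)" using Z_pos[of n t] by simp
    also have "\<dots> \<le> C * (\<Sum>i\<in>F. D i powr t + \<theta> * (1 / 2) ^ Suc i)"
      using r(3) \<open>C > 0\<close> by (intro mult_left_mono sum_mono) (auto intro: less_imp_le)
    also have "(\<Sum>i\<in>F. D i powr t + \<theta> * (1 / 2) ^ Suc i) = (\<Sum>i\<in>F. D i powr t) + \<theta> * (\<Sum>i\<in>F. (1 / 2) ^ Suc i)"
      by (simp add: sum.distrib sum_distrib_left)
    finally have le1: "1 \<le> C * ((\<Sum>i\<in>F. D i powr t) + \<theta> * (\<Sum>i\<in>F. (1 / 2) ^ Suc i))" .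
    have half: "(\<Sum>i\<in>F. (1 / 2 :: real) ^ Suc i) \<le> 1"
    proof -
      have "(\<Sum>i\<in>F. (1 / 2 :: real) ^ Suc i) \<le> (\<Sum>i. (1 / 2) ^ Suc i)"
        using power_half_series F by (intro sum_le_suminf) (auto simp: sums_iff)
      then show ?thesis using power_half_series by (simp add: sums_iff)
    qed
    have "C * ((\<Sum>i\<in>F. D i powr t) + \<theta> * (\<Sum>i\<in>F. (1 / 2) ^ Suc i)) \<le> C * ((\<Sum>i\<in>F. D i powr t) + \<theta> * 1)"
      using \<open>C > 0\<close> \<open>\<theta> > 0\<close> by (intro mult_left_mono add_left_mono half) auto
    then have "1 \<le> C * ((\<Sum>i\<in>F. D i powr t) + \<theta> * 1)" using le1 by linarith
    then have "\<theta> \<le> (\<Sum>i\<in>F. D i powr t)" using \<open>C > 0\<close> by (simp add: \<theta>_def field_simps)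
    then have "ennreal \<theta> \<le> ennreal (\<Sum>i\<in>F. D i powr t)" by (rule ennreal_leI)
    also have "\<dots> = (\<Sum>i\<in>F. ennreal (D i powr t))" by (rule sum_ennreal[symmetric]) auto
    also have "\<dots> \<le> (\<Sum>i\<in>F. (if U i = {} then 0 else if s = 0 then 1 else ennreal (diameter (U i) powr s)))"
    proof (rule sum_mono)
      fix i assume "i \<in> F"
      then have "U i \<noteq> {}" using F by (auto simp: N_def)
      \<comment> \<open>Covers \<open>s = 0\<close>, where a nonempty set counts 1.\<close>
      moreover have "D i powr t \<le> 1" using D[of i] \<delta> \<open>t > 0\<close> by (intro powr_le1) auto
      moreover have "D i powr t \<le> D i powr s"
        using D[of i] \<delta> assms by (cases "D i = 0") (auto intro!: powr_mono')
      ultimately show "ennreal (D i powr t) \<le> (if U i = {} then 0 else if s = 0 then 1 else ennreal (diameter (U i) powr s))"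
        by (auto simp: D_def intro: ennreal_leI simp flip: ennreal_1)
    qed
    also have "\<dots> \<le> (\<Sum>i. (if U i = {} then 0 else if s = 0 then 1 else ennreal (diameter (U i) powr s)))"
      by (rule sum_le_suminf) (use F in auto)
    finally show ?thesis .
  qed
  have "0 < ennreal \<theta>" using \<open>\<theta> > 0\<close> by simp
  also have "ennreal \<theta> \<le> hausdorff_pre s \<delta> ?J"
    unfolding hausdorff_pre_def using key by (intro INF_greatest) auto
  also have "\<dots> \<le> hausdorff_measure s ?J"
    unfolding hausdorff_measure_def using \<delta> by (intro SUP_upper) auto
  finally show ?thesis .
qed

section \<open>The exponent is at most the dimension\<close>

text \<open>A ball containing all of \<open>X\<close>, of radius at least 1, is hit by every map and
  truncates none.\<close>

lemma packing_whole:
  assumes "finite S" and tame: "\<And>i. i \<in> S \<Longrightarrow> tame (f i)" and le1: "\<And>i. i \<in> S \<Longrightarrow> normD (f i) X \<le> 1"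
    and "\<And>i j. i \<in> S \<Longrightarrow> j \<in> S \<Longrightarrow> i \<noteq> j \<Longrightarrow> f i ` interior X \<inter> f j ` interior X = {}"
    and x: "x \<in> X" and r: "r \<ge> 1" "X \<subseteq> ball x r"
  shows "(\<Sum>i\<in>S. normD (f i) X ^ DIM('a)) \<le> packC * r ^ DIM('a)"
proof -
  have "(\<Sum>i\<in>S. min (normD (f i) X) r ^ DIM('a)) \<le> packC * r ^ DIM('a)"
  proof (rule packing)
    show "f i ` X \<inter> ball x r \<noteq> {}" if "i \<in> S" for i
    proof -
      have "f i x \<in> X" using x tame[OF that] by (auto simp: bd_conformal_def)
      then show ?thesis using r x by blast
    qed
  qed (use assms in auto)
  moreover have "min (normD (f i) X) r = normD (f i) X" if "i \<in> S" for i
    using r le1[OF that] by simp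
  ultimately show ?thesis by simp
qed

text \<open>Supplies the condition \<open>t \<le> d\<close> for the power mean. If
  \<open>t > d\<close>, packing bounds \<open>card (I (Suc k)) * c (Suc k) ^ d\<close> by
  \<open>B\<close> and makes \<open>Z k t\<close> decay like \<open>\<eta> powr (t - d)\<close> to
  the power \<open>k\<close>, so the product cannot stay above \<open>\<delta>\<close>.\<close>

lemma exponent_le_dim:
  assumes "t > 0" "\<delta> > 0" and c: "\<And>j a. j \<ge> 1 \<Longrightarrow> a \<in> I j \<Longrightarrow> c j \<le> letter j a" "\<And>j. j \<ge> 1 \<Longrightarrow> c j > 0"
    and low: "\<And>k. k \<ge> n0 \<Longrightarrow> \<delta> \<le> Z k t * real (card (I (Suc k))) powr (t / DIM('a)) * c (Suc k) powr t"
  shows "t \<le> real DIM('a)"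
proof (rule ccontr)
  let ?d = "DIM('a)"
  assume "\<not> ?thesis"
  then have td: "t > real ?d" by simp
  obtain x where x: "x \<in> X" using nonempty by blast
  obtain r' where "X \<subseteq> ball x r'" using compactX compact_imp_bounded bounded_subset_ballD by blast
  then obtain r where r: "r \<ge> 1" "X \<subseteq> ball x r" using that[of "max 1 r'"] by (meson max.cobounded1 max.cobounded2 subset_ball subset_trans)
  define B where "B = packC * r ^ ?d"
  have B: "B > 0" using packC_pos r by (simp add: B_def)
  have up: "Z k t * real (card (I (Suc k))) powr (t / ?d) * c (Suc k) powr t \<le> B * B powr (t / ?d) * (\<eta> powr (t - ?d)) ^ k" for k
  proof -
    have "(\<Sum>a\<in>I (Suc k). letter (Suc k) a ^ ?d) \<le> B"
      unfolding B_def
    proof (rule packing_whole[OF _ _ _ _ x r])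
      show "letter (Suc k) a \<le> 1" if "a \<in> I (Suc k)" for a using contraction[of "Suc k" a] \<eta>1 that by simp
    qed (use I_finite tame_letter osc in auto)
    moreover have "real (card (I (Suc k))) * c (Suc k) ^ ?d \<le> (\<Sum>a\<in>I (Suc k). letter (Suc k) a ^ ?d)"
      using sum_mono[of "I (Suc k)" "\<lambda>_. c (Suc k) ^ ?d" "\<lambda>a. letter (Suc k) a ^ ?d"] c less_imp_le[OF c(2)]
      by (simp add: power_mono)
    ultimately have "(real (card (I (Suc k))) * c (Suc k) ^ ?d) powr (t / ?d) \<le> B powr (t / ?d)"
      using \<open>t > 0\<close> c(2)[of "Suc k"] by (intro powr_mono2) auto
    moreover have "(real (card (I (Suc k))) * c (Suc k) ^ ?d) powr (t / ?d) = real (card (I (Suc k))) powr (t / ?d) * c (Suc k) powr t"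
      using c(2)[of "Suc k"] by (simp add: powr_mult powr_powr flip: powr_realpow)
    ultimately have 1: "real (card (I (Suc k))) powr (t / ?d) * c (Suc k) powr t \<le> B powr (t / ?d)" by simp
    have e: "(\<eta> ^ k) powr (t - ?d) = (\<eta> powr (t - ?d)) ^ k"
      using \<eta>_pos by (simp add: powr_powr mult.commute flip: powr_realpow)
    have sle: "wscale k w \<le> 1" if "w \<in> words I k" for w
      using wscale_le[OF valid_words[OF that]] power_le_one[of \<eta> k] \<eta>_pos \<eta>1 by linarith
    have "Z k t \<le> (\<Sum>w\<in>words I k. (\<eta> ^ k) powr (t - ?d) * wscale k w ^ ?d)"
      unfolding Z_eq
    proof (rule sum_mono)
      fix w assume w: "w \<in> words I k"
      have pos: "wscale k w > 0" using wscale_pos[OF valid_words[OF w]] .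
      \<comment> \<open>Split off the exponent \<open>d\<close>, whose sum packing controls; the
        surplus \<open>t - d\<close> yields the decay.\<close>
      have "wscale k w powr t = wscale k w powr (t - ?d) * wscale k w ^ ?d"
        using pos by (simp add: powr_diff powr_realpow)
      also have "\<dots> \<le> (\<eta> ^ k) powr (t - ?d) * wscale k w ^ ?d"
        using pos td wscale_le[OF valid_words[OF w]] by (intro mult_right_mono powr_mono2) auto
      finally show "wscale k w powr t \<le> (\<eta> ^ k) powr (t - ?d) * wscale k w ^ ?d" .
    qed
    also have "\<dots> = (\<eta> powr (t - ?d)) ^ k * (\<Sum>w\<in>words I k. wscale k w ^ ?d)" by (simp add: e sum_distrib_left)
    also have "(\<Sum>w\<in>words I k. wscale k w ^ ?d) \<le> B"
      unfolding wscale_def B_def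
    proof (rule packing_whole[OF finite_words _ _ _ x r])
      show "tame (comp_seg \<phi> w 1 k)" if "w \<in> words I k" for w using tame_comp valid_words that by blast
      show "normD (comp_seg \<phi> w 1 k) X \<le> 1" if "w \<in> words I k" for w using sle[OF that] by (simp add: wscale_def)
      show "comp_seg \<phi> v 1 k ` interior X \<inter> comp_seg \<phi> w 1 k ` interior X = {}"
        if "v \<in> words I k" "w \<in> words I k" "v \<noteq> w" for v w
        using words_differ[OF that] images_disjoint[OF valid_words[OF that(1)] valid_words[OF that(2)]] by blast
    qed
    finally have 2: "Z k t \<le> (\<eta> powr (t - ?d)) ^ k * B" using \<eta>_pos by simp
    have "Z k t * (real (card (I (Suc k))) powr (t / ?d) * c (Suc k) powr t) \<le> ((\<eta> powr (t - ?d)) ^ k * B) * B powr (t / ?d)"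
      using 1 2 B Z_pos[of k t] by (intro mult_mono) auto
    then show ?thesis by (simp add: mult_ac)
  qed
  have "\<eta> powr (t - ?d) < 1" using \<eta>_pos \<eta>1 td powr_less_mono2[of "t - ?d" \<eta> 1] by simp
  then have "(\<lambda>k. (\<eta> powr (t - ?d)) ^ k) \<longlonglongrightarrow> 0" by (intro LIMSEQ_realpow_zero) auto
  then have "(\<lambda>k. B * B powr (t / ?d) * (\<eta> powr (t - ?d)) ^ k) \<longlonglongrightarrow> B * B powr (t / ?d) * 0" by (rule tendsto_mult_left)
  then have "\<forall>\<^sub>F k in sequentially. B * B powr (t / ?d) * (\<eta> powr (t - ?d)) ^ k < \<delta>"
    using \<open>\<delta> > 0\<close> by (intro order_tendstoD(2)) auto
  then obtain m where m: "\<And>k. k \<ge> m \<Longrightarrow> B * B powr (t / ?d) * (\<eta> powr (t - ?d)) ^ k < \<delta>"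
    by (auto simp: eventually_sequentially)
  show False using m[of "max m n0"] up[of "max m n0"] low[of "max m n0"] by simp
qed

end

section \<open>From the given system to the locales, and the conclusion\<close>

lemma (in bd_domain) tame_comp_seg:
  assumes maps: "\<And>j i. j \<ge> 1 \<Longrightarrow> i \<in> I j \<Longrightarrow> \<phi> j i ` X \<subseteq> X"
    and conf: "\<And>j i. j \<ge> 1 \<Longrightarrow> i \<in> I j \<Longrightarrow> conformal_diffeo_into (\<phi> j i) V"
    and bdp: "\<And>k l w x y. 1 \<le> k \<Longrightarrow> k \<le> l \<Longrightarrow> (\<And>j. j \<in> {k..l} \<Longrightarrow> w j \<in> I j) \<Longrightarrow> x \<in> V \<Longrightarrow> y \<in> V \<Longrightarrow>
        dscale (comp_seg \<phi> w k (Suc l - k)) x \<le> K * dscale (comp_seg \<phi> w k (Suc l - k)) y"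
    and k: "1 \<le> k" and w: "\<And>j. k \<le> j \<Longrightarrow> j < k + n \<Longrightarrow> w j \<in> I j"
  shows "tame (comp_seg \<phi> w k n)"
  using w
proof (induction n)
  \<comment> \<open>Bounded distortion is assumed for nonempty segments; the empty one is the
    identity.\<close>
  case 0
  show ?case using tame_id by (simp only: comp_seg.simps)
next
  case (Suc n)
  let ?f = "comp_seg \<phi> w k n" and ?g = "\<phi> (k + n) (w (k + n))"
  have f: "tame ?f" using Suc by simp
  have g: "?g ` X \<subseteq> X" "conformal_diffeo_into ?g V" using Suc.prems[of "k + n"] k by (simp_all add: maps conf)
  then have g': "?g ` V \<subseteq> V" "inj_on ?g V" "\<And>x. x \<in> V \<Longrightarrow> conformal_at ?g x"
    by (auto simp: conformal_diffeo_into_def)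
  have "(?f \<circ> ?g) ` V \<subseteq> V" "(?f \<circ> ?g) ` X \<subseteq> X"
    using f image_mono[OF g'(1), of ?f] image_mono[OF g(1), of ?f]
    unfolding bd_conformal_def image_comp[symmetric] by (meson order_trans)+
  moreover have "inj_on (?f \<circ> ?g) V"
    using f g' by (meson bd_conformal_def comp_inj_on inj_on_subset)
  moreover have "conformal_at (?f \<circ> ?g) x" if "x \<in> V" for x
    using f g' that by (intro conformal_at_compose) (auto simp: bd_conformal_def)
  moreover have "dscale (?f \<circ> ?g) x \<le> K * dscale (?f \<circ> ?g) y" if "x \<in> V" "y \<in> V" for x y
    using bdp[of k "k + n" w x y] Suc.prems k that by (simp add: Suc_diff_le)
  ultimately show ?case unfolding bd_conformal_def comp_seg.simps by (intro conjI ballI)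
qed

lemma finite_NCIFS_locale:
  fixes X :: "'a::euclidean_space set"
  assumes "finite_NCIFS X I \<phi>"
  obtains V K \<kappa> R \<eta> where "finite_ncifs X V K \<kappa> R I \<phi> \<eta>"
proof -
  have N: "NCIFS X I \<phi>" and fin: "\<And>j. j \<ge> 1 \<Longrightarrow> finite (I j)" using assms by (auto simp: finite_NCIFS_def)
  note N' = N[unfolded NCIFS_def]
  have adm: "admissible_X X"
    and I: "\<And>j. j \<ge> 1 \<Longrightarrow> I j \<noteq> {}" "\<And>j i. j \<ge> 1 \<Longrightarrow> i \<in> I j \<Longrightarrow> \<phi> j i ` X \<subseteq> X"
    and osc: "\<And>j a b. j \<ge> 1 \<Longrightarrow> a \<in> I j \<Longrightarrow> b \<in> I j \<Longrightarrow> a \<noteq> b \<Longrightarrow> \<phi> j a ` interior X \<inter> \<phi> j b ` interior X = {}"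
    using N' by simp_all
  obtain V K where V: "open V" "X \<subseteq> V" "\<And>j i. j \<ge> 1 \<Longrightarrow> i \<in> I j \<Longrightarrow> conformal_diffeo_into (\<phi> j i) V"
    and K: "K \<ge> 1" and bdp: "\<And>k l w x y. 1 \<le> k \<Longrightarrow> k \<le> l \<Longrightarrow> (\<And>j. j \<in> {k..l} \<Longrightarrow> w j \<in> I j) \<Longrightarrow> x \<in> V \<Longrightarrow> y \<in> V \<Longrightarrow>
        dscale (comp_seg \<phi> w k (Suc l - k)) x \<le> K * dscale (comp_seg \<phi> w k (Suc l - k)) y"
  proof -
    from N'[THEN conjunct2, THEN conjunct2, THEN conjunct2, THEN conjunct1]
    obtain V where V: "open V \<and> connected V \<and> X \<subseteq> V \<and> (\<forall>j\<ge>1. \<forall>i\<in>I j. conformal_diffeo_into (\<phi> j i) V) \<and>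
      (\<exists>K\<ge>1. \<forall>k l w. 1 \<le> k \<longrightarrow> k \<le> l \<longrightarrow> (\<forall>j\<in>{k..l}. w j \<in> I j) \<longrightarrow>
            (\<forall>x\<in>V. \<forall>y\<in>V. dscale (comp_seg \<phi> w k (Suc l - k)) x
                              \<le> K * dscale (comp_seg \<phi> w k (Suc l - k)) y))" ..
    from V[THEN conjunct2, THEN conjunct2, THEN conjunct2, THEN conjunct2] obtain K where "K \<ge> 1" "\<forall>k l w. 1 \<le> k \<longrightarrow> k \<le> l \<longrightarrow> (\<forall>j\<in>{k..l}. w j \<in> I j) \<longrightarrow>
            (\<forall>x\<in>V. \<forall>y\<in>V. dscale (comp_seg \<phi> w k (Suc l - k)) x
                              \<le> K * dscale (comp_seg \<phi> w k (Suc l - k)) y)"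
      by (elim exE conjE)
    then show thesis using V by (intro that[of V K]) simp_all
  qed
  obtain \<eta> where \<eta>: "\<eta> < 1" "\<And>j i. j \<ge> 1 \<Longrightarrow> i \<in> I j \<Longrightarrow> normD (\<phi> j i) X \<le> \<eta>"
    using N'[THEN conjunct2, THEN conjunct2, THEN conjunct2, THEN conjunct2] by blast
  have X: "X \<noteq> {}" "compact X" using adm by (auto simp: admissible_X_def)
  obtain \<kappa> R1 where \<kappa>: "\<kappa> > 0" "R1 > 0"
    "\<And>x \<rho>. x \<in> X \<Longrightarrow> 0 < \<rho> \<Longrightarrow> \<rho> \<le> R1 \<Longrightarrow> \<exists>y. ball y (\<kappa> * \<rho>) \<subseteq> X \<inter> ball x \<rho>"
    using admissible_corkscrew[OF adm] by blast
  \<comment> \<open>A Lebesgue number of the cover of the compact set \<open>X\<close> by the single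
    open set \<open>V\<close>.\<close>
  obtain R2 where R2: "R2 > 0" "\<And>x. x \<in> X \<Longrightarrow> ball x R2 \<subseteq> V"
    using Heine_Borel_lemma[of X "{V}"] X V by auto
  interpret bd_domain X V K using X V K by unfold_locales auto
  have "finite_ncifs X V K \<kappa> (min R1 R2) I \<phi> \<eta>"
  proof unfold_locales
    show "ball x (min R1 R2) \<subseteq> V" if "x \<in> X" for x using R2(2)[OF that] by auto
    show "tame (comp_seg \<phi> w k n)" if "1 \<le> k" "\<And>j. k \<le> j \<Longrightarrow> j < k + n \<Longrightarrow> w j \<in> I j" for k n w
      using I(2) V(3) bdp that by (rule tame_comp_seg)
  qed (use \<kappa> R2 I fin osc \<eta> X in auto)
  then show thesis by (rule that)
qed

theorem theorem3p2:
  fixes X :: "'a::euclidean_space set" and I :: "nat \<Rightarrow> 'i set" and \<phi> :: "nat \<Rightarrow> 'i \<Rightarrow> 'a \<Rightarrow> 'a"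
    and t :: real
  assumes "finite_NCIFS X I \<phi>"
    and "t \<ge> 0"
  defines "\<rho> \<equiv> \<lambda>n. Max {normD (\<phi> n a) X / normD (\<phi> n b) X | a b. a \<in> I n \<and> b \<in> I n}"
    and "Zt \<equiv> \<lambda>n. Zfun X I \<phi> (n - 1) t * real (card (I n)) powr (t / real DIM('a)) * Min ((\<lambda>a. normD (\<phi> n a) X) ` I n) powr t"
  assumes "liminf (\<lambda>n. ereal (Zt n / (1 + ln (Max (\<rho> ` {1..n}))))) > 0"
  shows "hausdorff_dim (limit_set X I \<phi>) \<ge> ereal t"
proof -
  obtain V K \<kappa> R \<eta> where "finite_ncifs X V K \<kappa> R I \<phi> \<eta>" using finite_NCIFS_locale[OF assms(1)] .
  then interpret finite_ncifs X V K \<kappa> R I \<phi> \<eta> .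
  define M where "M = (\<lambda>n. Max (\<rho> ` {1..n}))"
  define c where "c = (\<lambda>j. Min ((\<lambda>a. normD (\<phi> j a) X) ` I j))"
  have c: "c j \<le> normD (\<phi> j a) X" if "j \<ge> 1" "a \<in> I j" for j a
    using that I_finite by (auto simp: c_def)
  have c_pos: "c j > 0" if "j \<ge> 1" for j
    using that I_finite I_nonempty letter_pos by (auto simp: c_def)
  have \<rho>: "normD (\<phi> j a) X / normD (\<phi> j b) X \<le> \<rho> j" if "j \<ge> 1" "a \<in> I j" "b \<in> I j" for j a b
    unfolding \<rho>_def using that I_finite[OF that(1)] by (intro Max_ge finite_image_set2) auto
  have \<rho>M: "\<rho> j \<le> M n" if "1 \<le> j" "j \<le> n" for j n using that by (auto simp: M_def)
  interpret finite_ncifs_ratio X V K \<kappa> R I \<phi> \<eta> M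
  proof unfold_locales
    show "normD (\<phi> j a) X \<le> M j * normD (\<phi> j b) X" if "j \<ge> 1" "a \<in> I j" "b \<in> I j" for j a b
      using order_trans[OF \<rho>[OF that] \<rho>M[of j j]] letter_pos[of j b] that by (simp add: divide_le_eq)
    show "M i \<le> M j" if "1 \<le> i" "i \<le> j" for i j
      unfolding M_def using that by (intro Max_mono) auto
    show "1 \<le> M j" if "j \<ge> 1" for j
    proof -
      from I_nonempty[OF that] obtain a where a: "a \<in> I j" by blast
      show ?thesis using order_trans[OF \<rho>[OF that a a] \<rho>M[of j j]] letter_pos[OF that a] that by simp
    qed
  qed
  obtain \<delta> where \<delta>: "\<delta> > 0" "ereal \<delta> < liminf (\<lambda>n. ereal (Zt n / (1 + ln (M n))))"
    using ereal_dense2[OF assms(5)] by (auto simp: M_def)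
  then obtain n0 where n0: "\<And>n. n \<ge> n0 \<Longrightarrow> \<delta> < Zt n / (1 + ln (M n))"
    using less_LiminfD[OF \<delta>(2)] by (auto simp: eventually_sequentially)
  have L: "1 + ln (M (Suc k)) \<ge> 1" for k using M1[of "Suc k"] by simp
  have low: "\<delta> * (1 + ln (M (Suc k))) \<le> Zfun X I \<phi> k t * real (card (I (Suc k))) powr (t / real DIM('a)) * c (Suc k) powr t"
    if "k \<ge> n0" for k
    using n0[of "Suc k"] that L[of k] by (simp add: Zt_def c_def less_divide_eq)
  \<comment> \<open>For \<open>t = 0\<close> there is no such \<open>s\<close>; otherwise
    \<open>s < t\<close> supplies \<open>t > 0\<close>.\<close>
  have pos: "hausdorff_measure s (limit_set X I \<phi>) > 0" if s: "0 \<le> s" "s < t" for s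
  proof -
    have "t > 0" using s by simp
    have low1: "\<delta> \<le> Zfun X I \<phi> k t * real (card (I (Suc k))) powr (t / real DIM('a)) * c (Suc k) powr t"
      if "k \<ge> n0" for k
      using low[OF that] mult_left_mono[OF L[of k], of \<delta>] \<delta>(1) by linarith
    have td: "t \<le> real DIM('a)" by (rule exponent_le_dim[OF \<open>t > 0\<close> \<delta>(1) c c_pos low1])
    \<comment> \<open>All scales at levels up to \<open>n0\<close>; a radius below their minimum
      \<open>r0\<close> gives the condition \<open>big\<close> of
      \<open>ball_mass_le\<close>.\<close>
    define W where "W = insert 1 (\<Union>m\<in>{..n0}. wscale m ` words I m)"
    have W: "finite W" "\<And>y. y \<in> W \<Longrightarrow> y > 0"
      using finite_words wscale_pos[OF valid_words] by (auto simp: W_def)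
    define r0 where "r0 = Min W"
    have r0: "r0 > 0" "\<And>y. y \<in> W \<Longrightarrow> r0 \<le> y" using W by (auto simp: r0_def W_def)
    define C where "C = K powr t * K powr t * packC powr (t / DIM('a)) / \<delta> * (packC * chainC)"
    have "C > 0"
    proof -
      have "ln (1 / \<eta>) > 0" using \<eta>_pos \<eta>1 by (intro ln_gt_zero) auto
      then have "chainC > 0" unfolding chainC_def using K1 by (simp add: add_pos_nonneg)
      then show ?thesis unfolding C_def using packC_pos K1 \<delta>(1) by simp
    qed
    show ?thesis
    proof (rule hausdorff_measure_limit_set_pos[OF s(1) less_imp_le[OF s(2)] \<open>t > 0\<close> \<open>C > 0\<close> r0(1)])
      fix x r n assume r: "0 < r" "r < r0" and small: "\<And>u. u \<in> words I n \<Longrightarrow> wscale n u \<le> r"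
      have big: "r < wscale m w" if "m \<le> n0" "w \<in> words I m" for m w
        using r(2) r0(2)[of "wscale m w"] that by (force simp: W_def)
      show "(\<Sum>u\<in>{u \<in> words I n. comp_seg \<phi> u 1 n ` X \<inter> ball x r \<noteq> {}}. wscale n u powr t) \<le> C * r powr t * Zfun X I \<phi> n t"
        unfolding C_def by (rule ball_mass_le[OF \<open>t > 0\<close> td \<delta>(1) c c_pos low r(1) big small])
    qed
  qed
  show ?thesis
    unfolding hausdorff_dim_def
  proof (rule Inf_greatest)
    fix y assume "y \<in> {ereal s |s. s \<ge> 0 \<and> hausdorff_measure s (limit_set X I \<phi>) = 0}"
    then obtain s where s: "y = ereal s" "s \<ge> 0" "hausdorff_measure s (limit_set X I \<phi>) = 0" by blast
    then show "ereal t \<le> y" using pos[of s] by (cases "s < t") auto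
  qed
qed

end
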